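(* Let $\widehat{RE}(5,10)$ be the free $\mathbb F[\partial_1,\dots,\partial_5]$-module with the $\boldsymbol\lambda$-bracket described in the context, and let $RE(5,10)$ be its $\mathbb F[\boldsymbol\partial]$-submodule generated by $$a_{ij}=\partial_i\partial_{x_j}-\partial_j\partial_{x_i}\quad(i,j\in\{1,\dots,5\}),\qquad b_k=\sum_h\partial_hd_{hk}\quad(k\in\{1,\dots,5\}).$$ Then $RE(5,10)$, with the $\boldsymbol\lambda$-bracket induced from $\widehat{RE}(5,10)$, is a Lie conformal superalgebra of type $(5,0)$. On the generators the induced bracket is given by: - $[{a_{ij}}_{\boldsymbol\lambda}a_{rs}]=\lambda_j\lambda_ra_{si}+\lambda_i\lambda_ra_{js}+\lambda_i\lambda_sa_{rj}+\lambda_j\lambda_sa_{ir}+\lambda_i\partial_ja_{rs}+\lambda_j\partial_ia_{sr}$; - $[{a_{ij}}_{\boldsymbol\lambda}b_k]=(\lambda_i\partial_j-\lambda_j\partial_i)b_k+(\delta_{ik}\lambda_j-\delta_{jk}\lambda_i)\sum_r\lambda_rb_r$; - $[{b_i}_{\boldsymbol\lambda}b_i]=0$; - if $i\ne j$, $[{b_i}_{\boldsymbol\lambda}b_j]=\varepsilon_{ijhkl}(\lambda_ha_{kl}+\lambda_ka_{lh}+\lambda_la_{hk})$, where $\{i,j,h,k,l\}=\{1,2,3,4,5\}$ and $\varepsilon_{ijhkl}$ is the sign of the permutation $(i,j,h,k,l)$.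
   Context: $\mathbb F$ is an algebraically closed field of characteristic $0$; $\boldsymbol\lambda=(\lambda_1,\dots,\lambda_5)$, $\boldsymbol\mu$, $\boldsymbol\partial=(\partial_1,\dots,\partial_5)$ are sets of even commuting variables. A Lie conformal superalgebra of type $(5,0)$ is a $\mathbb Z/2$-graded $\mathbb F[\boldsymbol\partial]$-module $R$ with a parity-preserving linear $\boldsymbol\lambda$-bracket $R\otimes R\to\mathbb F[\boldsymbol\lambda]\otimes R$ satisfying (sesquilinearity) $[(\partial_ia)_{\boldsymbol\lambda}b]=-\lambda_i[a_{\boldsymbol\lambda}b]$, $[a_{\boldsymbol\lambda}(\partial_ib)]=(\partial_i+\lambda_i)[a_{\boldsymbol\lambda}b]$; (skew-symmetry) $[b_{\boldsymbol\lambda}a]=-(-1)^{p(a)p(b)}[a_{-\boldsymbol\lambda-\boldsymbol\partial}b]$; (Jacobi) $[a_{\boldsymbol\lambda}[b_{\boldsymbol\mu}c]]=[[a_{\boldsymbol\lambda}b]_{\boldsymbol\lambda+\boldsymbol\mu}c]+(-1)^{p(a)p(b)}[b_{\boldsymbol\mu}[a_{\boldsymbol\lambda}c]]$. $\widehat{RE}(5,10)$ is the free $\mathbb F[\boldsymbol\partial]$-module with even generators $\partial_{x_i}$ ($1\le i\le5$) and odd generators $d_{jk}$ ($1\le j<k\le5$); put $d_{jj}=0$, $d_{jk}=-d_{kj}$ for $j>k$. Its $\boldsymbol\lambda$-bracket (which does not satisfy the Jacobi identity on all of $\widehat{RE}(5,10)$) is extended by sesquilinearity from $[{\partial_{x_i}}_{\boldsymbol\lambda}\partial_{x_j}]=-(\partial_i+\lambda_i)\partial_{x_j}-\lambda_j\partial_{x_i}$;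 $[{\partial_{x_i}}_{\boldsymbol\lambda}d_{jk}]=-(\partial_i+\lambda_i)d_{jk}+\delta_{ij}\sum_h\lambda_hd_{hk}-\delta_{ki}\sum_r\lambda_rd_{rj}$; $[{d_{jk}}_{\boldsymbol\lambda}\partial_{x_i}]=-\lambda_id_{jk}+\delta_{ij}\sum_h(\lambda_h+\partial_h)d_{hk}-\delta_{ki}\sum_r(\lambda_r+\partial_r)d_{rj}$; $[{d_{ij}}_{\boldsymbol\lambda}d_{hk}]=\varepsilon_{ijhk}\partial_{x_{t}}$, where if $i,j,h,k$ are distinct $t$ is the remaining index of $\{1,\dots,5\}$ and $\varepsilon_{ijhk}$ is the sign of the permutation $(i,j,h,k,t)$, and $\varepsilon_{ijhk}=0$ otherwise. *)

theory Defs
  imports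
    "HOL-Computational_Algebra.Polynomial"
    "HOL-Library.Poly_Mapping"
    "HOL-Library.Numeral_Type"
    "HOL-Library.Z2"
    "HOL-Combinatorics.Permutations"
begin

section \<open>Polynomials with coefficients in a ring or a module\<close>

text \<open>
  \<open>('x, 'r) mpoly\<close> is the polynomial ring \<open>'r['x]\<close> in the variables \<open>'x\<close> when \<open>'r\<close> is a ring
  (the ring structure is the one of \<^theory>\<open>HOL-Library.Poly_Mapping\<close>). For an \<open>F[\<partial>]\<close>-module
  \<open>'m\<close> the type \<open>('x, 'm) mpoly\<close> is \<open>F['x] \<otimes>\<^sub>F 'm\<close>: an element is written uniquely as a finite
  sum of terms (monomial in \<open>'x\<close>) \<open>\<otimes>\<close> (element of \<open>'m\<close>), and its coefficients are these
  elements of \<open>'m\<close>. It is a module over \<open>F[\<partial>]['x] = F['x, \<partial>]\<close>, with \<open>\<partial>\<close> acting on the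
  coefficients and the variables \<open>'x\<close> shifting the exponents.
\<close>

type_synonym ('x, 'r) mpoly = "('x \<Rightarrow>\<^sub>0 nat) \<Rightarrow>\<^sub>0 'r"

definition pvar :: "'x \<Rightarrow> ('x, 'r::comm_ring_1) mpoly"
  where "pvar i = Poly_Mapping.single (Poly_Mapping.single i 1) 1"

definition pconst :: "'m::zero \<Rightarrow> ('x, 'm) mpoly"
  where "pconst c = Poly_Mapping.single 0 c"

definition pscale ::
  "('r \<Rightarrow> 'm \<Rightarrow> 'm) \<Rightarrow> ('x, 'r::comm_ring_1) mpoly \<Rightarrow> ('x, 'm::ab_group_add) mpoly \<Rightarrow> ('x, 'm) mpoly"
  where "pscale scale p P =
    (\<Sum>m\<in>Poly_Mapping.keys p. \<Sum>n\<in>Poly_Mapping.keys P.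
      Poly_Mapping.single (m + n) (scale (Poly_Mapping.lookup p m) (Poly_Mapping.lookup P n)))"

text \<open>
  For \<open>P = \<Sum>\<^sub>n X\<^sup>n \<otimes> c\<^sub>n\<close> this is \<open>\<Sum>\<^sub>n \<sigma>\<^sup>n \<phi>(c\<^sub>n)\<close>, where \<open>\<sigma>\<close> replaces the variables by
  polynomials in new variables, possibly involving \<open>\<partial>\<close>; any \<open>\<partial>\<close> in \<open>\<sigma>\<close> acts on \<open>\<phi>(c\<^sub>n)\<close>.
\<close>

definition psubst ::
  "('r \<Rightarrow> 'm \<Rightarrow> 'm) \<Rightarrow> ('x \<Rightarrow> ('y, 'r::comm_ring_1) mpoly) \<Rightarrow>
    ('n \<Rightarrow> ('y, 'm::ab_group_add) mpoly) \<Rightarrow> ('x::finite, 'n::zero) mpoly \<Rightarrow> ('y, 'm) mpoly"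
  where "psubst scale \<sigma> \<phi> P =
    (\<Sum>n\<in>Poly_Mapping.keys P.
      pscale scale (\<Prod>i\<in>UNIV. \<sigma> i ^ Poly_Mapping.lookup n i) (\<phi> (Poly_Mapping.lookup P n)))"


section \<open>Lie conformal superalgebras of type \<open>(CARD('v), 0)\<close>\<close>

text \<open>Scalars in \<open>F[\<partial>]['x]\<close>: the formal variable \<open>\<lambda>\<^sub>i\<close> is \<open>pvar i\<close>, while \<open>\<partial>\<^sub>i\<close> is a constant.\<close>

abbreviation lam :: "'v \<Rightarrow> ('v, ('v, 'a::comm_ring_1) mpoly) mpoly"
  where "lam i \<equiv> pvar i"

abbreviation del :: "'v \<Rightarrow> ('x, ('v, 'a::comm_ring_1) mpoly) mpoly"
  where "del i \<equiv> pconst (pvar i)"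

text \<open>The two sets of variables \<open>\<lambda>\<close>, \<open>\<mu>\<close> of the Jacobi identity, as variables indexed by \<open>'v + 'v\<close>.\<close>

abbreviation lam2 :: "'v \<Rightarrow> ('v + 'v, ('v, 'a::comm_ring_1) mpoly) mpoly"
  where "lam2 i \<equiv> pvar (Inl i)"

abbreviation mu2 :: "'v \<Rightarrow> ('v + 'v, ('v, 'a::comm_ring_1) mpoly) mpoly"
  where "mu2 i \<equiv> pvar (Inr i)"

text \<open>\<open>br_at scale br \<sigma> a b\<close> is \<open>[a\<^sub>\<sigma> b]\<close>, the bracket with \<open>\<lambda>\<^sub>i\<close> replaced by \<open>\<sigma> i\<close>.\<close>

definition br_at ::
  "('r \<Rightarrow> 'm \<Rightarrow> 'm) \<Rightarrow> ('m \<Rightarrow> 'm \<Rightarrow> ('v::finite, 'm) mpoly) \<Rightarrow> ('v \<Rightarrow> ('y, 'r::comm_ring_1) mpoly) \<Rightarrow>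
    'm \<Rightarrow> 'm \<Rightarrow> ('y, 'm::ab_group_add) mpoly"
  where "br_at scale br \<sigma> a b = psubst scale \<sigma> pconst (br a b)"

definition koszul :: "bit \<Rightarrow> bit \<Rightarrow> 'b::comm_ring_1"
  where "koszul p q = (if p = 1 \<and> q = 1 then - 1 else 1)"

text \<open>
  The \<open>F[\<partial>]\<close>-module is \<open>R\<close>, a submodule of an ambient module; the values of \<open>br\<close> outside
  \<open>R\<close> are irrelevant. The homogeneous components are \<open>grade 0\<close> (even) and \<open>grade 1\<close> (odd).
\<close>

locale lie_conformal_superalgebra = module scale
  for scale :: "('v::finite, 'a::field) mpoly \<Rightarrow> 'm::ab_group_add \<Rightarrow> 'm" +
  fixes R :: "'m set"
    and grade :: "bit \<Rightarrow> 'm set"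
    and br :: "'m \<Rightarrow> 'm \<Rightarrow> ('v, 'm) mpoly"
  assumes subspace_carrier: "subspace R"
    and subspace_grade: "subspace (grade p)"
    and grade_sum: "R = {x + y |x y. x \<in> grade 0 \<and> y \<in> grade 1}"
    and grade_Int: "grade 0 \<inter> grade 1 = {0}"
    and br_closed: "a \<in> R \<Longrightarrow> b \<in> R \<Longrightarrow> Poly_Mapping.lookup (br a b) n \<in> R"
    and br_add_left: "a \<in> R \<Longrightarrow> a' \<in> R \<Longrightarrow> b \<in> R \<Longrightarrow> br (a + a') b = br a b + br a' b"
    and br_add_right: "a \<in> R \<Longrightarrow> b \<in> R \<Longrightarrow> b' \<in> R \<Longrightarrow> br a (b + b') = br a b + br a b'"
    and br_scalar_left: "a \<in> R \<Longrightarrow> b \<in> R \<Longrightarrow>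
      br (scale (pconst s) a) b = pscale scale (pconst (pconst s)) (br a b)"
    and br_scalar_right: "a \<in> R \<Longrightarrow> b \<in> R \<Longrightarrow>
      br a (scale (pconst s) b) = pscale scale (pconst (pconst s)) (br a b)"
    and br_parity: "a \<in> grade p \<Longrightarrow> b \<in> grade q \<Longrightarrow>
      Poly_Mapping.lookup (br a b) n \<in> grade (p + q)"
    and sesquilinear_left: "a \<in> R \<Longrightarrow> b \<in> R \<Longrightarrow>
      br (scale (pvar i) a) b = pscale scale (- lam i) (br a b)"
    and sesquilinear_right: "a \<in> R \<Longrightarrow> b \<in> R \<Longrightarrow>
      br a (scale (pvar i) b) = pscale scale (del i + lam i) (br a b)"
    and skew_symmetric: "a \<in> grade p \<Longrightarrow> b \<in> grade q \<Longrightarrow>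
      br b a = - pscale scale (koszul p q) (br_at scale br (\<lambda>i. - lam i - del i) a b)"
    and jacobi: "a \<in> grade p \<Longrightarrow> b \<in> grade q \<Longrightarrow> c \<in> R \<Longrightarrow>
      psubst scale mu2 (\<lambda>x. br_at scale br lam2 a x) (br b c) =
      psubst scale lam2 (\<lambda>x. br_at scale br (\<lambda>i. lam2 i + mu2 i) x c) (br a b) +
      pscale scale (koszul p q) (psubst scale lam2 (\<lambda>x. br_at scale br mu2 b x) (br a c))"


section \<open>The free module with \<open>\<lambda>\<close>-bracket containing \<open>RE(5,10)\<close>\<close>

text \<open>
  The indices \<open>1, \<dots>, 5\<close> are the elements \<open>0, \<dots>, 4\<close> of the type \<open>5\<close>, in this order.
\<close>

typedef ipair = "{(j :: 5, k :: 5). j < k}"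
proof
  show "(0, 1) \<in> {(j :: 5, k :: 5). j < k}"
    by (simp add: less_bit1_def bit1.Rep_0 bit1.Rep_1)
qed

datatype gen = GenX "5" | GenD ipair

type_synonym 'a hatRE = "gen \<Rightarrow>\<^sub>0 (5, 'a) mpoly"

definition hscale :: "(5, 'a::comm_ring_1) mpoly \<Rightarrow> 'a hatRE \<Rightarrow> 'a hatRE"
  where "hscale p v = Poly_Mapping.map ((*) p) v"

lemma lookup_hscale: "Poly_Mapping.lookup (hscale p v) x = p * Poly_Mapping.lookup v x"
  by (simp add: hscale_def Poly_Mapping.map.rep_eq when_def)

lemma module_hscale: "module hscale"
  by unfold_locales (auto intro!: poly_mapping_eqI simp: lookup_hscale lookup_add algebra_simps)

definition dx :: "5 \<Rightarrow> 'a::comm_ring_1 hatRE"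
  where "dx i = Poly_Mapping.single (GenX i) 1"

definition dd :: "5 \<Rightarrow> 5 \<Rightarrow> 'a::comm_ring_1 hatRE"
  where "dd j k =
    (if j < k then Poly_Mapping.single (GenD (Abs_ipair (j, k))) 1
     else if k < j then - Poly_Mapping.single (GenD (Abs_ipair (k, j))) 1
     else 0)"

definition hgrade :: "bit \<Rightarrow> 'a::comm_ring_1 hatRE set"
  where "hgrade p = {v. Poly_Mapping.keys v \<subseteq> (if p = 0 then range GenX else range GenD)}"

text \<open>Sign of the permutation \<open>(i, j, h, k, l)\<close>; only used when the five indices are distinct.\<close>

definition sign5 :: "5 \<Rightarrow> 5 \<Rightarrow> 5 \<Rightarrow> 5 \<Rightarrow> 5 \<Rightarrow> int"
  where "sign5 i j h k l =
    sign (\<lambda>n::5. if n = 0 then i else if n = 1 then j else if n = 2 then h else if n = 3 then k else l)"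

text \<open>\<open>p \<cdot> v\<close> in \<open>F[\<lambda>] \<otimes> R\<close> for \<open>p\<close> in \<open>F[\<lambda>, \<partial>]\<close> and \<open>v\<close> in \<open>R\<close>\<close>

definition hterm :: "(5, (5, 'a::comm_ring_1) mpoly) mpoly \<Rightarrow> 'a hatRE \<Rightarrow> (5, 'a hatRE) mpoly"
    (infixl "\<cdot>" 70)
  where "p \<cdot> v = pscale hscale p (pconst v)"

fun gen_br :: "gen \<Rightarrow> gen \<Rightarrow> (5, 'a::comm_ring_1 hatRE) mpoly"
  where
    "gen_br (GenX i) (GenX j) = - ((del i + lam i) \<cdot> dx j) - lam j \<cdot> dx i"
  | "gen_br (GenX i) (GenD p) = (case Rep_ipair p of (j, k) \<Rightarrow>
      - ((del i + lam i) \<cdot> dd j k)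
      + (if i = j then \<Sum>h\<in>UNIV. lam h \<cdot> dd h k else 0)
      - (if k = i then \<Sum>r\<in>UNIV. lam r \<cdot> dd r j else 0))"
  | "gen_br (GenD p) (GenX i) = (case Rep_ipair p of (j, k) \<Rightarrow>
      - (lam i \<cdot> dd j k)
      + (if i = j then \<Sum>h\<in>UNIV. (lam h + del h) \<cdot> dd h k else 0)
      - (if k = i then \<Sum>r\<in>UNIV. (lam r + del r) \<cdot> dd r j else 0))"
  | "gen_br (GenD p) (GenD q) = (case (Rep_ipair p, Rep_ipair q) of ((i, j), (h, k)) \<Rightarrow>
      (if distinct [i, j, h, k]
       then let t = (THE t. t \<notin> {i, j, h, k}) in of_int (sign5 i j h k t) \<cdot> dx t
       else 0))"

text \<open>Value of \<open>f\<close> in \<open>F[\<partial>]\<close> when each \<open>\<partial>\<^sub>i\<close> is replaced by \<open>\<sigma> i\<close> in \<open>F[\<lambda>, \<partial>]\<close>\<close>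

definition peval ::
  "(5 \<Rightarrow> (5, (5, 'a) mpoly) mpoly) \<Rightarrow> (5, 'a::comm_ring_1) mpoly \<Rightarrow> (5, (5, 'a) mpoly) mpoly"
  where "peval \<sigma> f =
    (\<Sum>m\<in>Poly_Mapping.keys f.
      pconst (pconst (Poly_Mapping.lookup f m)) * (\<Prod>i\<in>UNIV. \<sigma> i ^ Poly_Mapping.lookup m i))"

text \<open>Sesquilinearity gives \<open>[(f(\<partial>) u)\<^sub>\<lambda> (g(\<partial>) v)] = f(-\<lambda>) g(\<partial> + \<lambda>) [u\<^sub>\<lambda> v]\<close>.\<close>

definition hbr :: "'a::comm_ring_1 hatRE \<Rightarrow> 'a hatRE \<Rightarrow> (5, 'a hatRE) mpoly"
  where "hbr a b =
    (\<Sum>u\<in>Poly_Mapping.keys a. \<Sum>v\<in>Poly_Mapping.keys b.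
      pscale hscale
        (peval (\<lambda>i. - lam i) (Poly_Mapping.lookup a u) *
         peval (\<lambda>i. del i + lam i) (Poly_Mapping.lookup b v))
        (gen_br u v))"


section \<open>The submodule \<open>RE(5,10)\<close>\<close>

definition a_gen :: "5 \<Rightarrow> 5 \<Rightarrow> 'a::comm_ring_1 hatRE"
  where "a_gen i j = hscale (pvar i) (dx j) - hscale (pvar j) (dx i)"

definition b_gen :: "5 \<Rightarrow> 'a::comm_ring_1 hatRE"
  where "b_gen k = (\<Sum>h\<in>UNIV. hscale (pvar h) (dd h k))"

definition RE :: "'a::comm_ring_1 hatRE set"
  where "RE = module.span hscale ({a_gen i j |i j. True} \<union> {b_gen k |k. True})"

definition RE_grade :: "bit \<Rightarrow> 'a::comm_ring_1 hatRE set"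
  where "RE_grade p = RE \<inter> hgrade p"

end

theory Submission
  imports Defs
begin

text \<open>
  Over an infinite field a polynomial is determined by its values, so every identity of the theorem
  can be checked after evaluating \<open>\<lambda>\<close>, \<open>\<mu>\<close> and \<open>\<partial>\<close> at points. The value of an element of the
  free module at a point \<open>p\<close> is a pair of a vector \<open>A\<close> and a 2-form \<open>w\<close> on a five-dimensional
  space, to be read as a vector field and a 2-form with the factor \<open>exp (p * x)\<close>. Up to sign,
  the \<open>\<lambda>\<close>-bracket becomes the commutator of vector fields, the Lie derivative of 2-forms, and the
  product of 2-forms with values in 4-forms, which are vector fields by means of the volume form.
  At a point, elements of \<open>RE(5,10)\<close> have a divergence-free vector field (\<open>A * p = 0\<close>) and a closed
  2-form (\<open>p \<and> w = 0\<close>), and these are exactly the conditions under which the Jacobi identity holds: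
  with one vector field and two 2-forms it uses \<open>A * p = 0\<close>, and with three 2-forms it reduces, by
  Cartan's formula for closed forms, to the vanishing of the cyclic sum of the contractions of
  \<open>w\<close> with \<open>v \<and> u\<close>. Closure of \<open>RE(5,10)\<close> follows from the formulas on generators by
  sesquilinearity.
\<close>

section \<open>Evaluation of polynomials\<close>

definition eval_monom :: "('x::finite \<Rightarrow> 'a::comm_ring_1) \<Rightarrow> ('x \<Rightarrow>\<^sub>0 nat) \<Rightarrow> 'a"
  where "eval_monom x n = (\<Prod>i\<in>UNIV. x i ^ Poly_Mapping.lookup n i)"

lemma eval_monom_0 [simp]: "eval_monom x 0 = 1"
  by (simp add: eval_monom_def)

lemma eval_monom_add: "eval_monom x (m + n) = eval_monom x m * eval_monom x n"
  by (simp add: eval_monom_def lookup_add power_add prod.distrib)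

lemma eval_monom_single [simp]: "eval_monom x (Poly_Mapping.single i k) = x i ^ k"
proof -
  have "eval_monom x (Poly_Mapping.single i k) = (\<Prod>j\<in>UNIV. if j = i then x i ^ k else 1)"
    unfolding eval_monom_def by (rule prod.cong) (auto simp: lookup_single)
  then show ?thesis by simp
qed

lemma poly_mapping_sum_monomials:
  "(\<Sum>k\<in>Poly_Mapping.keys p. Poly_Mapping.single k (Poly_Mapping.lookup p k)) = p"
  by (rule poly_mapping_eqI) (auto simp: lookup_sum lookup_single when_def in_keys_iff)

text \<open>The coefficients pass through an arbitrary functional \<open>\<phi>\<close>. One
  definition thus serves polynomials over a ring and over a module, and evaluations can be nested:
  \<open>\<partial>\<close> is evaluated inside \<open>\<phi>\<close>, the formal variables at
  \<open>x\<close>.\<close>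

definition eval_mp :: "('m::zero \<Rightarrow> 'a::comm_ring_1) \<Rightarrow> ('x::finite \<Rightarrow> 'a) \<Rightarrow> ('x, 'm) mpoly \<Rightarrow> 'a"
  where "eval_mp \<phi> x P = (\<Sum>n\<in>Poly_Mapping.keys P. \<phi> (Poly_Mapping.lookup P n) * eval_monom x n)"

lemma eval_mp_superset:
  assumes "finite A" "Poly_Mapping.keys P \<subseteq> A" "\<phi> 0 = 0"
  shows "eval_mp \<phi> x P = (\<Sum>n\<in>A. \<phi> (Poly_Mapping.lookup P n) * eval_monom x n)"
  unfolding eval_mp_def
  by (rule sum.mono_neutral_left) (use assms in \<open>auto simp: in_keys_iff\<close>)

lemma eval_mp_additive:
  fixes \<phi> :: "'m::ab_group_add \<Rightarrow> 'a::comm_ring_1" and x :: "'x::finite \<Rightarrow> 'a"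
  assumes "additive \<phi>"
  shows "additive (eval_mp \<phi> x)"
proof
  fix P Q :: "('x, 'm) mpoly"
  interpret additive \<phi> by fact
  let ?A = "Poly_Mapping.keys P \<union> Poly_Mapping.keys Q"
  have "Poly_Mapping.keys (P + Q) \<subseteq> ?A" by (rule keys_add)
  then have "eval_mp \<phi> x (P + Q) = (\<Sum>n\<in>?A. \<phi> (Poly_Mapping.lookup (P + Q) n) * eval_monom x n)"
    by (intro eval_mp_superset) (auto simp: zero)
  also have "\<dots> = (\<Sum>n\<in>?A. \<phi> (Poly_Mapping.lookup P n) * eval_monom x n) + (\<Sum>n\<in>?A. \<phi> (Poly_Mapping.lookup Q n) * eval_monom x n)"
    by (simp add: lookup_add add algebra_simps sum.distrib)
  also have "\<dots> = eval_mp \<phi> x P + eval_mp \<phi> x Q"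
    by (simp add: eval_mp_superset[of ?A] zero)
  finally show "eval_mp \<phi> x (P + Q) = eval_mp \<phi> x P + eval_mp \<phi> x Q" .
qed

lemma eval_mp_single [simp]:
  assumes "\<phi> 0 = 0"
  shows "eval_mp \<phi> x (Poly_Mapping.single n c) = \<phi> c * eval_monom x n"
  using assms by (simp add: eval_mp_def)

lemma eval_mp_pscale:
  fixes P :: "('x::finite, 'm::ab_group_add) mpoly"
  assumes "additive \<phi>" "additive \<psi>" "\<And>r m. \<psi> (scale r m) = \<phi> r * \<psi> m"
  shows "eval_mp \<psi> x (pscale scale p P) = eval_mp \<phi> x p * eval_mp \<psi> x P"
proof -
  interpret p: additive \<psi> by fact
  interpret q: additive "eval_mp \<psi> x :: ('x, 'm) mpoly \<Rightarrow> _" by (rule eval_mp_additive) fact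
  show ?thesis
    by (simp add: pscale_def q.sum p.zero assms(3) eval_monom_add)
      (simp add: eval_mp_def sum_product algebra_simps)
qed

lemma mult_eq_pscale: "(p::('x, 'r::comm_ring_1) mpoly) * q = pscale (*) p q"
proof -
  have "p * q = (\<Sum>m\<in>Poly_Mapping.keys p. Poly_Mapping.single m (Poly_Mapping.lookup p m)) *
     (\<Sum>m\<in>Poly_Mapping.keys q. Poly_Mapping.single m (Poly_Mapping.lookup q m))"
    by (simp add: poly_mapping_sum_monomials)
  then show ?thesis by (simp add: sum_product mult_single pscale_def)
qed

section \<open>Evaluation as a ring homomorphism, and its effect on substitutions\<close>

locale ring_morphism = additive \<phi> for \<phi> :: "'r::comm_ring_1 \<Rightarrow> 'a::comm_ring_1" +
  assumes map_1: "\<phi> 1 = 1"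
    and map_mult: "\<phi> (x * y) = \<phi> x * \<phi> y"
begin

lemma map_power: "\<phi> (x ^ n) = \<phi> x ^ n"
  by (induction n) (simp_all add: map_1 map_mult)

lemma map_prod: "\<phi> (prod f S) = (\<Prod>i\<in>S. \<phi> (f i))"
  by (induction S rule: infinite_finite_induct) (simp_all add: map_1 map_mult)

lemma map_of_nat: "\<phi> (of_nat n) = of_nat n"
  by (induction n) (simp_all add: zero add map_1)

lemma map_of_int: "\<phi> (of_int n) = of_int n"
  by (cases n rule: int_cases2) (simp_all add: minus map_of_nat)

lemma ring_morphism_eval_mp: "ring_morphism (eval_mp \<phi> x)"
proof -
  have a: "additive \<phi>" ..
  interpret e: additive "eval_mp \<phi> x" by (rule eval_mp_additive[OF a])
  show ?thesis
  proof
    show "eval_mp \<phi> x 1 = 1"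
      by (simp add: zero map_1 flip: single_one)
    show "eval_mp \<phi> x (p * q) = eval_mp \<phi> x p * eval_mp \<phi> x q" for p q :: "('b, 'r) mpoly"
      unfolding mult_eq_pscale by (rule eval_mp_pscale[OF a a]) (rule map_mult)
  qed
qed

lemma eval_mp_pconst: "eval_mp \<phi> x (pconst c) = \<phi> c"
  by (simp add: pconst_def zero)

lemma eval_mp_pvar: "eval_mp \<phi> x (pvar i) = x i"
  by (simp add: pvar_def zero map_1)

end

text \<open>The map \<open>\<theta>\<close> is absorbed into the functional on coefficients, so a
  bracket nested inside another bracket can be evaluated from the outside inwards.\<close>

lemma eval_mp_psubst:
  fixes P :: "('x::finite, 'n::zero) mpoly"
  assumes "ring_morphism \<phi>" "additive \<psi>" "\<And>r m. \<psi> (scale r m) = \<phi> r * \<psi> m"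
  shows "eval_mp \<psi> y (psubst scale \<sigma> \<theta> P) = eval_mp (\<lambda>c. eval_mp \<psi> y (\<theta> c)) (\<lambda>i. eval_mp \<phi> y (\<sigma> i)) P"
proof -
  interpret r: ring_morphism \<phi> by fact
  have a: "additive \<phi>" ..
  interpret e: ring_morphism "eval_mp \<phi> y" by (rule r.ring_morphism_eval_mp)
  interpret q: additive "eval_mp \<psi> y" by (rule eval_mp_additive) fact
  show ?thesis
    unfolding psubst_def q.sum eval_mp_pscale[OF a assms(2,3)]
    unfolding eval_mp_def[of "\<lambda>c. eval_mp \<psi> y (\<theta> c)"]
    by (simp add: eval_monom_def e.map_prod e.map_power algebra_simps)
qed

text \<open>Induction on the variables. Fixing all variables but \<open>i\<close> leaves a
  univariate polynomial vanishing on an infinite domain, hence zero. Its coefficient at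
  \<open>k\<close> collects the monomials of \<open>S\<close> with exponent \<open>k\<close> at
  \<open>i\<close>, and these are still separated by the remaining variables.\<close>

lemma multivariate_monomials_independent:
  fixes c :: "('x \<Rightarrow>\<^sub>0 nat) \<Rightarrow> 'a::{idom, ring_char_0}"
  assumes "finite V" "finite S"
    and "\<And>m n. m \<in> S \<Longrightarrow> n \<in> S \<Longrightarrow> (\<And>i. i \<in> V \<Longrightarrow> Poly_Mapping.lookup m i = Poly_Mapping.lookup n i) \<Longrightarrow> m = n"
    and "\<And>x. (\<Sum>m\<in>S. c m * (\<Prod>i\<in>V. x i ^ Poly_Mapping.lookup m i)) = 0"
    and "m \<in> S"
  shows "c m = 0"
  using assms
proof (induction V arbitrary: S rule: finite_induct)
  case empty
  then have "S = {m}" by auto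
  with empty.prems(3) show ?case by simp
next
  case (insert i V)
  define k where "k = Poly_Mapping.lookup m i"
  define S' where "S' = {n\<in>S. Poly_Mapping.lookup n i = k}"
  show ?case
  proof (rule insert.IH[of S'])
    show "finite S'" "m \<in> S'" using insert.prems by (auto simp: S'_def k_def)
    show "m1 = m2" if "m1 \<in> S'" "m2 \<in> S'"
      and "\<And>i. i \<in> V \<Longrightarrow> Poly_Mapping.lookup m1 i = Poly_Mapping.lookup m2 i" for m1 m2
      by (rule insert.prems(2)) (use that in \<open>auto simp: S'_def\<close>)
    fix x :: "'x \<Rightarrow> 'a"
    define C where "C n = c n * (\<Prod>j\<in>V. x j ^ Poly_Mapping.lookup n j)" for n
    define Q where "Q = (\<Sum>n\<in>S. monom (C n) (Poly_Mapping.lookup n i))"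
    have "poly Q t = 0" for t
    proof -
      have "poly Q t = (\<Sum>n\<in>S. c n * (\<Prod>j\<in>insert i V. (x(i := t)) j ^ Poly_Mapping.lookup n j))"
        unfolding Q_def poly_sum
      proof (rule sum.cong[OF refl])
        fix n
        have "(\<Prod>j\<in>V. (x(i := t)) j ^ Poly_Mapping.lookup n j) = (\<Prod>j\<in>V. x j ^ Poly_Mapping.lookup n j)"
          by (rule prod.cong) (use insert.hyps in auto)
        then show "poly (monom (C n) (Poly_Mapping.lookup n i)) t =
          c n * (\<Prod>j\<in>insert i V. (x(i := t)) j ^ Poly_Mapping.lookup n j)"
          using insert.hyps by (simp add: C_def poly_monom)
      qed
      then show ?thesis by (simp only: insert.prems(3))
    qed
    then have "Q = 0" by (simp add: poly_all_0_iff_0 flip: poly_all_0_iff_0)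
    then have "coeff Q k = 0" by simp
    also have "coeff Q k = (\<Sum>n\<in>S'. C n)"
      using insert.prems(1)
      by (simp add: Q_def coeff_sum S'_def sum.inter_filter)
    finally show "(\<Sum>n\<in>S'. c n * (\<Prod>j\<in>V. x j ^ Poly_Mapping.lookup n j)) = 0"
      by (simp add: C_def)
  qed
qed

lemma eval_mp_eq_0_imp:
  fixes P :: "('x::finite, 'm::zero) mpoly" and \<phi> :: "'m \<Rightarrow> 'a::{idom, ring_char_0}"
  assumes "\<And>x. eval_mp \<phi> x P = 0" "\<phi> 0 = 0"
  shows "\<phi> (Poly_Mapping.lookup P n) = 0"
proof (cases "n \<in> Poly_Mapping.keys P")
  case True
  show ?thesis
    by (rule multivariate_monomials_independent[where V = UNIV and S = "Poly_Mapping.keys P"])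
      (use assms True in \<open>auto simp: eval_mp_def eval_monom_def intro!: poly_mapping_eqI\<close>)
qed (simp add: in_keys_iff assms)

section \<open>Five indices and the sign\<close>

lemma less5 [simp]:
  "(0::5) < 1" "(0::5) < 2" "(0::5) < 3" "(0::5) < 4"
  "(1::5) < 2" "(1::5) < 3" "(1::5) < 4" "(2::5) < 3" "(2::5) < 4" "(3::5) < 4"
  "\<not> (1::5) < 0" "\<not> (2::5) < 0" "\<not> (3::5) < 0" "\<not> (4::5) < 0"
  "\<not> (2::5) < 1" "\<not> (3::5) < 1" "\<not> (4::5) < 1" "\<not> (3::5) < 2" "\<not> (4::5) < 2" "\<not> (4::5) < 3"
  by (simp_all add: less_bit1_def bit1.Rep_0 bit1.Rep_1 bit1.Rep_numeral)

lemma cases5: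
  obtains "i = (0::5)" | "i = 1" | "i = 2" | "i = 3" | "i = 4"
proof (cases i)
  case (of_int z)
  then have "z = 0 \<or> z = 1 \<or> z = 2 \<or> z = 3 \<or> z = 4" by auto
  then show ?thesis using of_int that by fastforce
qed

lemma UNIV5: "(UNIV :: 5 set) = {0, 1, 2, 3, 4}"
  using cases5 by auto

lemma sum5: "(\<Sum>i\<in>UNIV. f i) = f (0::5) + f 1 + f 2 + f 3 + f 4"
  unfolding UNIV5 by (simp add: add.assoc)

lemma bij_gen5:
  assumes "distinct [i, j, h, k, l]"
  shows "permutation (\<lambda>n::5. if n = 0 then i else if n = 1 then j else if n = 2 then h else if n = 3 then k else (l::5))"
proof -
  let ?f = "\<lambda>n::5. if n = 0 then i else if n = 1 then j else if n = 2 then h else if n = 3 then k else l"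
  have "inj ?f"
  proof (rule injI)
    fix x y assume "?f x = ?f y"
    then show "x = y"
      using assms by (cases x rule: cases5; cases y rule: cases5) simp_all
  qed
  then have "bij ?f" by (intro bijI finite_UNIV_inj_surj finite)
  then show ?thesis by (simp add: permutation)
qed

text \<open>Exchanging two adjacent entries is precomposition with a transposition of the two
  positions, which is odd.\<close>

lemma sign5_swap:
  assumes "distinct [i, j, h, k, l]"
  shows "sign5 j i h k l = - sign5 i j h k l" "sign5 i h j k l = - sign5 i j h k l"
    "sign5 i j k h l = - sign5 i j h k l" "sign5 i j h l k = - sign5 i j h k l"
proof -
  let ?f = "\<lambda>n::5. if n = 0 then i else if n = 1 then j else if n = 2 then h else if n = 3 then k else l"
  have *: "sign (?f \<circ> Transposition.transpose a b) = - sign5 i j h k l" if "a \<noteq> b" for a b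
    using that bij_gen5[OF assms] by (simp add: sign_compose permutation_swap_id sign_swap_id sign5_def)
  show "sign5 j i h k l = - sign5 i j h k l"
    unfolding *[of 0 1, simplified, symmetric] unfolding sign5_def
    by (rule arg_cong[where f = sign], rule ext) (auto simp: Transposition.transpose_def)
  show "sign5 i h j k l = - sign5 i j h k l"
    unfolding *[of 1 2, simplified, symmetric] unfolding sign5_def
    by (rule arg_cong[where f = sign], rule ext) (auto simp: Transposition.transpose_def)
  show "sign5 i j k h l = - sign5 i j h k l"
    unfolding *[of 2 3, simplified, symmetric] unfolding sign5_def
    by (rule arg_cong[where f = sign], rule ext) (auto simp: Transposition.transpose_def)
  show "sign5 i j h l k = - sign5 i j h k l"
    unfolding *[of 3 4, simplified, symmetric] unfolding sign5_def
  \<comment> \<open>The fifth entry is the default of the \<open>if\<close> cascade, so position 4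
    is only recognised by a case distinction on \<open>n\<close>.\<close>
  proof (rule arg_cong[where f = sign], rule ext)
    fix n show "(if n = 0 then i else if n = 1 then j else if n = 2 then h else if n = 3 then l else k) = (?f \<circ> Transposition.transpose 3 4) n"
      by (cases n rule: cases5) (simp_all add: Transposition.transpose_def)
  qed
qed

lemma sign5_id: "sign5 0 1 2 3 4 = 1"
proof -
  have "(\<lambda>n::5. if n = 0 then 0 else if n = 1 then 1 else if n = 2 then 2 else if n = 3 then 3 else 4) = id"
  proof
    fix n :: 5 show "(if n = 0 then 0 else if n = 1 then 1 else if n = 2 then 2 else if n = 3 then 3 else 4) = id n"
      by (cases n rule: cases5) simp_all
  qed
  then show ?thesis by (simp add: sign5_def)
qed

text \<open>The order hypotheses orient the swaps towards the increasing arrangement: rewriting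
  sorts concrete entries until \<open>sign5_id\<close> applies.\<close>

lemma sign5_sort:
  assumes "distinct [i, j, h, k, l]"
  shows "j < i \<Longrightarrow> sign5 i j h k l = - sign5 j i h k l"
    "h < j \<Longrightarrow> sign5 i j h k l = - sign5 i h j k l"
    "k < h \<Longrightarrow> sign5 i j h k l = - sign5 i j k h l"
    "l < k \<Longrightarrow> sign5 i j h k l = - sign5 i j h l k"
  using sign5_swap[OF assms] by (simp_all only: minus_minus)

text \<open>The coefficient of the product of the 2-forms \<open>w\<close> and \<open>v\<close> at \<open>dx\<^sub>i dx\<^sub>j dx\<^sub>h dx\<^sub>k\<close>.\<close>

definition wedge_coeff :: "('n \<Rightarrow> 'n \<Rightarrow> 'a::comm_ring_1) \<Rightarrow> ('n \<Rightarrow> 'n \<Rightarrow> 'a) \<Rightarrow> 'n \<Rightarrow> 'n \<Rightarrow> 'n \<Rightarrow> 'n \<Rightarrow> 'a"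
  where "wedge_coeff w v i j h k =
    w i j * v h k - w i h * v j k + w i k * v j h + w j h * v i k - w j k * v i h + w h k * v i j"

text \<open>4-forms are identified with vectors by means of the volume form.\<close>

definition wedge :: "(5 \<Rightarrow> 5 \<Rightarrow> 'a::comm_ring_1) \<Rightarrow> (5 \<Rightarrow> 5 \<Rightarrow> 'a) \<Rightarrow> 5 \<Rightarrow> 'a"
  where "wedge w v t =
    (if t = 0 then wedge_coeff w v 1 2 3 4 else if t = 1 then - wedge_coeff w v 0 2 3 4
     else if t = 2 then wedge_coeff w v 0 1 3 4 else if t = 3 then - wedge_coeff w v 0 1 2 4 else wedge_coeff w v 0 1 2 3)"

definition alternating :: "('n \<Rightarrow> 'n \<Rightarrow> 'a::comm_ring_1) \<Rightarrow> bool"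
  where "alternating w \<longleftrightarrow> (\<forall>i j. w i j = - w j i) \<and> (\<forall>i. w i i = 0)"

text \<open>Rewrite rules that bring the entries of an alternating matrix to increasing index pairs,
  a normal form for coordinate expansions.\<close>

lemma alternating_simps:
  assumes "alternating w"
  shows "w i i = 0" "(j::5) < i \<Longrightarrow> w i j = - w j i"
  using assms unfolding alternating_def by blast+

lemma wedge_coeff_swap:
  assumes "alternating w" "alternating v"
  shows "wedge_coeff w v j i h k = - wedge_coeff w v i j h k" "wedge_coeff w v i h j k = - wedge_coeff w v i j h k"
    "wedge_coeff w v i j k h = - wedge_coeff w v i j h k"
proof -
  have w: "w a b = - w b a" "v a b = - v b a" for a b
    using assms unfolding alternating_def by blast+
  show "wedge_coeff w v j i h k = - wedge_coeff w v i j h k"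
    unfolding wedge_coeff_def w[of j i] by (simp add: algebra_simps)
  show "wedge_coeff w v i h j k = - wedge_coeff w v i j h k"
    unfolding wedge_coeff_def w[of h j] by (simp add: algebra_simps)
  show "wedge_coeff w v i j k h = - wedge_coeff w v i j h k"
    unfolding wedge_coeff_def w[of k h] by (simp add: algebra_simps)
qed

text \<open>There are five increasing quadruples, each determining the missing index
  \<open>l\<close>; they match the five branches of \<open>wedge\<close>.\<close>

lemma wedge_eq_wedge_coeff_sorted:
  assumes "i < j" "j < h" "h < k" "distinct [i, j, h, k, l]"
  shows "wedge w v l = of_int (sign5 i j h k l) * wedge_coeff w v i j h k"
proof -
  consider "i = 0" "j = 1" "h = 2" "k = 3" | "i = 0" "j = 1" "h = 2" "k = 4" | "i = 0" "j = 1" "h = 3" "k = 4"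
    | "i = 0" "j = 2" "h = 3" "k = 4" | "i = 1" "j = 2" "h = 3" "k = 4"
    using assms(1-3)
    by (cases i rule: cases5; cases j rule: cases5; cases h rule: cases5; cases k rule: cases5)
      (simp_all only: less5 order.irrefl simp_thms)
  then consider "(i, j, h, k, l) = (0, 1, 2, 3, 4)" | "(i, j, h, k, l) = (0, 1, 2, 4, 3)" | "(i, j, h, k, l) = (0, 1, 3, 4, 2)"
    | "(i, j, h, k, l) = (0, 2, 3, 4, 1)" | "(i, j, h, k, l) = (1, 2, 3, 4, 0)"
    using assms(4) by cases (cases l rule: cases5; simp)+
  then show ?thesis
    unfolding prod.inject
    by cases (simp_all only:, simp_all add: wedge_def sign5_sort sign5_id)
qed

text \<open>Insertion sort by adjacent exchanges: \<open>3\<close> inserts the last entry into an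
  increasing triple, \<open>2\<close> inserts the third entry into an increasing pair.\<close>

lemma wlog_sorted4:
  fixes P :: "'n::linorder \<Rightarrow> 'n \<Rightarrow> 'n \<Rightarrow> 'n \<Rightarrow> bool"
  assumes sorted: "\<And>i j h k. i < j \<Longrightarrow> j < h \<Longrightarrow> h < k \<Longrightarrow> P i j h k"
    and swap: "\<And>i j h k. P i j h k \<Longrightarrow> P j i h k" "\<And>i j h k. P i j h k \<Longrightarrow> P i h j k"
      "\<And>i j h k. P i j h k \<Longrightarrow> P i j k h"
    and "distinct [i, j, h, k]"
  shows "P i j h k"
proof -
  have 3: "P i j h k" if "i < j" "j < h" "k \<noteq> i" "k \<noteq> j" "k \<noteq> h" for i j h k
  proof -
    consider "k < i" | "i < k" "k < j" | "j < k" "k < h" | "h < k"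
      using \<open>k \<noteq> i\<close> \<open>k \<noteq> j\<close> \<open>k \<noteq> h\<close> by (meson neqE)
    then show ?thesis
      using that(1,2) by cases (meson sorted swap)+
  qed
  have 2: "P i j h k" if "i < j" "distinct [i, j, h, k]" for i j h k
  proof -
    have d: "k \<noteq> i" "k \<noteq> j" "k \<noteq> h" and n: "h \<noteq> i" "h \<noteq> j" using that by auto
    consider "h < i" | "i < h" "h < j" | "j < h"
      using n by (meson neqE)
    then show ?thesis
      using that(1) d by cases (metis 3 swap)+
  qed
  show ?thesis
  proof (cases "i < j")
    case True with assms(5) show ?thesis by (rule 2[rotated])
  next
    case False
    then have "j < i" using assms(5) by auto
    then have "P j i h k" by (rule 2) (use assms(5) in auto)
    then show ?thesis by (rule swap)
  qed
qed

text \<open>Under an adjacent exchange among the first four indices both \<open>sign5\<close> and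
  \<open>wedge_coeff\<close> change sign, so their product is unchanged and the increasing case
  suffices.\<close>

lemma wedge_eq_wedge_coeff:
  assumes wv: "alternating w" "alternating v" and "distinct [i, j, h, k, l]"
  shows "wedge w v l = of_int (sign5 i j h k l) * wedge_coeff w v i j h k"
proof -
  have "distinct [i, j, h, k, l] \<longrightarrow> wedge w v l = of_int (sign5 i j h k l) * wedge_coeff w v i j h k"
    (is "?P i j h k")
  proof (rule wlog_sorted4[where P = ?P])
    show "distinct [i, j, h, k]" using assms by auto
  next
    fix i j h k :: 5
    show "i < j \<Longrightarrow> j < h \<Longrightarrow> h < k \<Longrightarrow> ?P i j h k"
      by (rule impI) (rule wedge_eq_wedge_coeff_sorted)
  next
    fix i j h k assume P: "?P i j h k"
    have d: "distinct [i, j, h, k, l]" if "distinct [j, i, h, k, l] \<or> distinct [i, h, j, k, l] \<or> distinct [i, j, k, h, l]"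
      using that by auto
    note s = sign5_swap(1-3)[of i j h k l] wedge_coeff_swap[OF wv, where i = i and j = j and h = h and k = k]
    show "?P j i h k" "?P i h j k" "?P i j k h"
      using P d by (auto simp only: s simp_thms of_int_minus mult_minus_left mult_minus_right minus_minus)
  qed
  with assms(3) show ?thesis by blast
qed

section \<open>Values of elements of the free module\<close>

text \<open>Allows the sums over supports in \<open>hbr\<close> to be extended to sums over all
  generators.\<close>

lemma finite_gen [simp, intro]: "finite (A :: gen set)"
proof -
  have "finite (UNIV :: ipair set)"
  proof (rule finite_imageD)
    show "finite (range Rep_ipair)" by (rule finite_subset[of _ UNIV]) auto
  qed (auto intro!: injI simp: Rep_ipair_inject)
  then have "finite (range GenX \<union> range GenD)" by simp
  moreover have "A \<subseteq> range GenX \<union> range GenD" by (auto intro: gen.exhaust)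
  ultimately show ?thesis by (rule rev_finite_subset)
qed

lemma sum_ipair:
  fixes F :: "ipair \<Rightarrow> 'b::comm_monoid_add"
  shows "sum F UNIV = (\<Sum>(j, k) | j < k. F (Abs_ipair (j, k)))"
  by (rule sum.reindex_bij_witness[of _ Abs_ipair Rep_ipair])
    (use Rep_ipair in \<open>auto simp: Rep_ipair_inverse Abs_ipair_inverse\<close>)

lemma sum_gen:
  fixes F :: "gen \<Rightarrow> 'b::comm_monoid_add"
  shows "sum F UNIV = (\<Sum>i\<in>UNIV. F (GenX i)) + (\<Sum>p\<in>UNIV. F (GenD p))"
proof -
  have "UNIV = range GenX \<union> range GenD" by (auto intro: gen.exhaust)
  then have "sum F UNIV = sum F (range GenX \<union> range GenD)" by (rule arg_cong)
  also have "\<dots> = sum F (range GenX) + sum F (range GenD)"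
    by (rule sum.union_disjoint) auto
  finally show ?thesis by (simp add: sum.reindex inj_on_def)
qed

section \<open>Nested evaluation of \<open>\<partial>\<close> and the formal variables\<close>

abbreviation eval_del :: "(5 \<Rightarrow> 'a::comm_ring_1) \<Rightarrow> (5, 'a) mpoly \<Rightarrow> 'a"
  where "eval_del d \<equiv> eval_mp (\<lambda>c. c) d"

lemma ring_morphism_eval_del: "ring_morphism (eval_del d)"
proof -
  interpret ring_morphism "\<lambda>c::'a::comm_ring_1. c" by unfold_locales auto
  show ?thesis by (rule ring_morphism_eval_mp)
qed

interpretation eval_del: ring_morphism "eval_del d" by (rule ring_morphism_eval_del)

interpretation eval_lam_del: ring_morphism "eval_mp (eval_del d) x" by (rule eval_del.ring_morphism_eval_mp)

lemma eval_del_pconst [simp]: "eval_del d (pconst c) = c"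
  by (simp add: pconst_def)

lemma eval_del_pvar [simp]: "eval_del d (pvar i) = d i"
  by (simp add: pvar_def)

lemma eval_lam_del_pconst [simp]: "eval_mp (eval_del d) x (pconst c) = eval_del d c"
  by (rule eval_del.eval_mp_pconst)

lemma eval_lam_del_pvar [simp]: "eval_mp (eval_del d) x (pvar i) = x i"
  by (rule eval_del.eval_mp_pvar)

lemmas eval_hom [simp] = eval_del.zero eval_del.add eval_del.minus eval_del.diff eval_del.map_1 eval_del.map_mult eval_del.map_of_int
  eval_lam_del.zero eval_lam_del.add eval_lam_del.minus eval_lam_del.diff eval_lam_del.map_1 eval_lam_del.map_mult eval_lam_del.map_of_int

lemma eval_lam_del_peval: "eval_mp (eval_del d) x (peval \<sigma> f) = eval_del (\<lambda>i. eval_mp (eval_del d) x (\<sigma> i)) f"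
  by (simp add: peval_def eval_lam_del.sum eval_lam_del.map_prod eval_lam_del.map_power)
    (simp add: eval_mp_def eval_monom_def)

lemma eval_del_eqI:
  fixes p q :: "(5, 'a::{idom, ring_char_0}) mpoly"
  assumes "\<And>d. eval_del d p = eval_del d q"
  shows "p = q"
proof (rule poly_mapping_eqI)
  fix n
  have "Poly_Mapping.lookup (p - q) n = 0"
    by (rule eval_mp_eq_0_imp) (simp_all add: assms)
  then show "Poly_Mapping.lookup p n = Poly_Mapping.lookup q n" by (simp add: lookup_minus)
qed

text \<open>The common setting for all coordinates of the value at a point \<open>d\<close>:
  additive functionals on which a polynomial in \<open>\<partial>\<close> acts through its value at
  \<open>d\<close>.\<close>

locale point_functional = additive \<chi> for \<chi> :: "'a::comm_ring_1 hatRE \<Rightarrow> 'a" +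
  fixes d :: "5 \<Rightarrow> 'a"
  assumes scale: "\<chi> (hscale p v) = eval_del d p * \<chi> v"
begin

lemma additive_ev: "additive (eval_mp \<chi> x)"
  by (rule eval_mp_additive) unfold_locales

lemma ev_pscale: "eval_mp \<chi> x (pscale hscale p P) = eval_mp (eval_del d) x p * eval_mp \<chi> x P"
  by (rule eval_mp_pscale) (unfold_locales, rule scale)

lemma ev_pconst: "eval_mp \<chi> x (pconst v) = \<chi> v"
  by (simp add: pconst_def zero)

lemma ev_hterm: "eval_mp \<chi> x (p \<cdot> v) = eval_mp (eval_del d) x p * \<chi> v"
  by (simp add: hterm_def ev_pscale ev_pconst)

lemma ev_psubst:
  "eval_mp \<chi> y (psubst hscale \<sigma> \<theta> P) = eval_mp (\<lambda>c. eval_mp \<chi> y (\<theta> c)) (\<lambda>i. eval_mp (eval_del d) y (\<sigma> i)) P"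
  by (rule eval_mp_psubst) (unfold_locales, rule scale)

lemma ev_br_at:
  "eval_mp \<chi> y (br_at hscale br \<sigma> a b) = eval_mp \<chi> (\<lambda>i. eval_mp (eval_del d) y (\<sigma> i)) (br a b)"
  by (simp add: br_at_def ev_psubst ev_pconst)

lemma ev_hbr:
  "eval_mp \<chi> x (hbr a b) = (\<Sum>u\<in>UNIV. \<Sum>v\<in>UNIV.
     eval_del (\<lambda>i. - x i) (Poly_Mapping.lookup a u) * eval_del (\<lambda>i. d i + x i) (Poly_Mapping.lookup b v) *
     eval_mp \<chi> x (gen_br u v))"
proof -
  interpret e: additive "eval_mp \<chi> x" by (rule additive_ev)
  have "eval_mp \<chi> x (hbr a b) = (\<Sum>u\<in>Poly_Mapping.keys a. \<Sum>v\<in>Poly_Mapping.keys b.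
     eval_del (\<lambda>i. - x i) (Poly_Mapping.lookup a u) * eval_del (\<lambda>i. d i + x i) (Poly_Mapping.lookup b v) *
     eval_mp \<chi> x (gen_br u v))"
    by (simp add: hbr_def e.sum ev_pscale eval_lam_del_peval)
  also have "\<dots> = (\<Sum>u\<in>Poly_Mapping.keys a. \<Sum>v\<in>UNIV.
     eval_del (\<lambda>i. - x i) (Poly_Mapping.lookup a u) * eval_del (\<lambda>i. d i + x i) (Poly_Mapping.lookup b v) *
     eval_mp \<chi> x (gen_br u v))"
    by (intro sum.cong refl sum.mono_neutral_left) (auto simp: in_keys_iff)
  also have "\<dots> = (\<Sum>u\<in>UNIV. \<Sum>v\<in>UNIV.
     eval_del (\<lambda>i. - x i) (Poly_Mapping.lookup a u) * eval_del (\<lambda>i. d i + x i) (Poly_Mapping.lookup b v) *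
     eval_mp \<chi> x (gen_br u v))"
    by (intro sum.mono_neutral_left) (auto simp: in_keys_iff)
  finally show ?thesis .
qed

end

definition vec_at :: "(5 \<Rightarrow> 'a::comm_ring_1) \<Rightarrow> 'a hatRE \<Rightarrow> 5 \<Rightarrow> 'a"
  where "vec_at d v i = eval_del d (Poly_Mapping.lookup v (GenX i))"

text \<open>The coefficients at the odd generators are extended to an alternating matrix, so that
  sums may run over all pairs of indices.\<close>

definition form_at :: "(5 \<Rightarrow> 'a::comm_ring_1) \<Rightarrow> 'a hatRE \<Rightarrow> 5 \<Rightarrow> 5 \<Rightarrow> 'a"
  where "form_at d v j k =
    (if j < k then eval_del d (Poly_Mapping.lookup v (GenD (Abs_ipair (j, k))))
     else if k < j then - eval_del d (Poly_Mapping.lookup v (GenD (Abs_ipair (k, j)))) else 0)"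

interpretation vec_at: point_functional "\<lambda>v. vec_at d v i" d
  by unfold_locales (simp_all add: vec_at_def lookup_add lookup_hscale)

interpretation form_at: point_functional "\<lambda>v. form_at d v j k" d
  by unfold_locales (simp_all add: form_at_def lookup_add lookup_hscale)

interpretation vec_eval: additive "eval_mp (\<lambda>v. vec_at d v i) x" by (rule vec_at.additive_ev)

interpretation form_eval: additive "eval_mp (\<lambda>v. form_at d v j k) x" by (rule form_at.additive_ev)

lemmas comp_simps [simp] = vec_at.zero vec_at.add vec_at.minus vec_at.diff vec_at.scale
  form_at.zero form_at.add form_at.minus form_at.diff form_at.scale
  vec_eval.zero vec_eval.add vec_eval.minus vec_eval.diff vec_at.ev_pscale vec_at.ev_hterm vec_at.ev_pconst
  form_eval.zero form_eval.add form_eval.minus form_eval.diff form_at.ev_pscale form_at.ev_hterm form_at.ev_pconst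

lemma alternating_form_at: "alternating (form_at d v)"
  by (auto simp: alternating_def form_at_def)

lemma hatRE_eqI:
  fixes v w :: "'a::{idom, ring_char_0} hatRE"
  assumes "\<And>d i. vec_at d v i = vec_at d w i" "\<And>d j k. form_at d v j k = form_at d w j k"
  shows "v = w"
proof (rule poly_mapping_eqI)
  fix u
  show "Poly_Mapping.lookup v u = Poly_Mapping.lookup w u"
  proof (rule eval_del_eqI)
    fix d show "eval_del d (Poly_Mapping.lookup v u) = eval_del d (Poly_Mapping.lookup w u)"
    proof (cases u)
      case (GenX i)
      then show ?thesis using assms(1)[of d i] by (simp add: vec_at_def)
    next
      case (GenD p)
      obtain j k where p: "p = Abs_ipair (j, k)" "j < k"
        by (cases p) auto
      then show ?thesis using assms(2)[of d j k] by (simp add: form_at_def GenD)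
    qed
  qed
qed

text \<open>This reduces bracket identities to scalar identities: \<open>d\<close> is the value of
  \<open>\<partial>\<close> and \<open>x\<close> that of the formal variables. The index type of the
  variables is any finite one, so that the Jacobi identity with its two sets of variables is
  covered.\<close>

lemma hpoly_eqI:
  fixes P Q :: "('y::finite, 'a::{idom, ring_char_0} hatRE) mpoly"
  assumes "\<And>d x i. eval_mp (\<lambda>v. vec_at d v i) x P = eval_mp (\<lambda>v. vec_at d v i) x Q"
    and "\<And>d x j k. eval_mp (\<lambda>v. form_at d v j k) x P = eval_mp (\<lambda>v. form_at d v j k) x Q"
  shows "P = Q"
proof (rule poly_mapping_eqI)
  fix n
  show "Poly_Mapping.lookup P n = Poly_Mapping.lookup Q n"
  proof (rule hatRE_eqI)
    fix d i
    have "vec_at d (Poly_Mapping.lookup (P - Q) n) i = 0"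
      by (rule eval_mp_eq_0_imp[where \<phi> = "\<lambda>v. vec_at d v i"]) (simp_all add: assms)
    then show "vec_at d (Poly_Mapping.lookup P n) i = vec_at d (Poly_Mapping.lookup Q n) i"
      by (simp add: lookup_minus)
  next
    fix d j k
    have "form_at d (Poly_Mapping.lookup (P - Q) n) j k = 0"
      by (rule eval_mp_eq_0_imp[where \<phi> = "\<lambda>v. form_at d v j k"]) (simp_all add: assms)
    then show "form_at d (Poly_Mapping.lookup P n) j k = form_at d (Poly_Mapping.lookup Q n) j k"
      by (simp add: lookup_minus)
  qed
qed

definition kron :: "5 \<Rightarrow> 5 \<Rightarrow> 'a::comm_ring_1"
  where "kron i j = (if i = j then 1 else 0)"

lemma Abs_ipair_eq: "j < k \<Longrightarrow> h < m \<Longrightarrow> Abs_ipair (j, k) = Abs_ipair (h, m) \<longleftrightarrow> j = h \<and> k = m"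
  by (simp add: Abs_ipair_inject)

lemma vec_at_dx [simp]: "vec_at d (dx i) j = kron i j" and form_at_dx [simp]: "form_at d (dx i) j k = 0"
  by (simp_all add: vec_at_def form_at_def dx_def lookup_single kron_def)

lemma vec_at_dd [simp]: "vec_at d (dd j k) i = 0"
  by (simp add: vec_at_def dd_def lookup_single)

lemma form_at_dd [simp]: "form_at d (dd j k) h m = kron j h * kron k m - kron j m * kron k h"
  by (auto simp: form_at_def dd_def lookup_single kron_def Abs_ipair_eq when_def)

section \<open>The bracket at a point\<close>

definition inner5 :: "(5 \<Rightarrow> 'a::comm_ring_1) \<Rightarrow> (5 \<Rightarrow> 'a) \<Rightarrow> 'a"
  where "inner5 A q = (\<Sum>i\<in>UNIV. A i * q i)"

definition contract :: "(5 \<Rightarrow> 'a::comm_ring_1) \<Rightarrow> (5 \<Rightarrow> 5 \<Rightarrow> 'a) \<Rightarrow> 5 \<Rightarrow> 'a"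
  where "contract A w k = (\<Sum>h\<in>UNIV. A h * w h k)"

text \<open>
  Momentum picture: \<open>A\<close> and \<open>w\<close> are the coefficients of a vector field and of a 2-form with exponential
  factor \<open>exp (p * x)\<close>; \<open>lie_deriv p q A w\<close> is the Lie derivative of \<open>w exp (q * x)\<close> along \<open>A exp (p * x)\<close>.
\<close>

definition lie_deriv :: "(5 \<Rightarrow> 'a::comm_ring_1) \<Rightarrow> (5 \<Rightarrow> 'a) \<Rightarrow> (5 \<Rightarrow> 'a) \<Rightarrow> (5 \<Rightarrow> 5 \<Rightarrow> 'a) \<Rightarrow> 5 \<Rightarrow> 5 \<Rightarrow> 'a"
  where "lie_deriv p q A w j k = inner5 A q * w j k + p j * contract A w k - p k * contract A w j"

lemma kron_simps [simp]:
  "kron i i = 1" "(\<Sum>i\<in>UNIV. kron i j * f i) = f j" "(\<Sum>i\<in>UNIV. kron j i * f i) = f j"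
  "(\<Sum>i\<in>UNIV. f i * kron i j) = f j" "(\<Sum>i\<in>UNIV. f i * kron j i) = f j"
proof -
  have *: "(\<Sum>i\<in>UNIV. if i = j then f i else 0) = f j" by simp
  show "(\<Sum>i\<in>UNIV. kron i j * f i) = f j" "(\<Sum>i\<in>UNIV. kron j i * f i) = f j"
    "(\<Sum>i\<in>UNIV. f i * kron i j) = f j" "(\<Sum>i\<in>UNIV. f i * kron j i) = f j"
    unfolding *[symmetric] by (rule sum.cong; simp add: kron_def)+
qed (simp add: kron_def)

lemma sum_kron_pair: "(\<Sum>r\<in>UNIV. F r * (kron r h * c - kron r m * e)) = F h * c - F m * (e :: 'a::comm_ring_1)"
proof -
  have "(\<Sum>r\<in>UNIV. F r * (kron r h * c - kron r m * e)) =
    (\<Sum>r\<in>UNIV. kron r h * (F r * c)) - (\<Sum>r\<in>UNIV. kron r m * (F r * e))"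
    by (simp add: algebra_simps sum_subtractf del: kron_simps)
  then show ?thesis by simp
qed

lemma pairs5: "{(j, k :: 5). j < k} =
  {(0, 1), (0, 2), (0, 3), (0, 4), (1, 2), (1, 3), (1, 4), (2, 3), (2, 4), (3, 4)}" (is "?L = ?R")
proof
  show "?L \<subseteq> ?R"
  proof
    fix z assume "z \<in> ?L"
    then obtain j k where "z = (j, k)" "j < k" by auto
    then show "z \<in> ?R" by (cases j rule: cases5; cases k rule: cases5; simp)
  qed
qed auto

lemma sum_pairs5: "(\<Sum>(j, k) | j < k. G j (k :: 5)) =
  G 0 1 + G 0 2 + G 0 3 + G 0 4 + G 1 2 + G 1 3 + G 1 4 + G 2 3 + G 2 4 + G 3 4"
  unfolding pairs5 by (simp add: add.assoc)

text \<open>In the full sum the diagonal vanishes, and the terms at \<open>(j, k)\<close> and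
  \<open>(k, j)\<close> combine because \<open>w\<close> is alternating.\<close>

lemma sum_pairs_antisym:
  fixes w :: "5 \<Rightarrow> 5 \<Rightarrow> 'a::comm_ring_1"
  assumes "alternating w"
  shows "(\<Sum>(j, k) | j < k. w j k * (\<alpha> j * \<beta> k - \<alpha> k * \<beta> j)) =
    (\<Sum>j\<in>UNIV. \<Sum>k\<in>UNIV. w j k * (\<alpha> j * \<beta> k))"
  by (simp add: sum_pairs5 sum5 alternating_simps[OF assms] algebra_simps)

lemma sum_gen_components:
  "(\<Sum>u\<in>UNIV. eval_del p (Poly_Mapping.lookup a u) * F u) =
    (\<Sum>i\<in>UNIV. vec_at p a i * F (GenX i)) + (\<Sum>(j, k) | j < k. form_at p a j k * F (GenD (Abs_ipair (j, k))))"
  unfolding sum_gen sum_ipair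
  by (intro arg_cong2[where f = "(+)"] sum.cong) (auto simp: vec_at_def form_at_def)

context point_functional
begin

text \<open>The four sums are the even-even, even-odd, odd-even and odd-odd blocks; sesquilinearity
  puts \<open>a\<close> at \<open>- x\<close> and \<open>b\<close> at \<open>d + x\<close>.\<close>

lemma ev_hbr_components:
  "eval_mp \<chi> x (hbr a b) =
    (let p = (\<lambda>i. - x i); q = (\<lambda>i. d i + x i); \<beta> = (\<lambda>u v. eval_mp \<chi> x (gen_br u v)) in
      (\<Sum>i\<in>UNIV. vec_at p a i * (\<Sum>j\<in>UNIV. vec_at q b j * \<beta> (GenX i) (GenX j))) +
      (\<Sum>i\<in>UNIV. vec_at p a i * (\<Sum>(h, k) | h < k. form_at q b h k * \<beta> (GenX i) (GenD (Abs_ipair (h, k))))) +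
      (\<Sum>(h, k) | h < k. form_at p a h k * (\<Sum>i\<in>UNIV. vec_at q b i * \<beta> (GenD (Abs_ipair (h, k))) (GenX i))) +
      (\<Sum>(i, j) | i < j. form_at p a i j *
        (\<Sum>(h, k) | h < k. form_at q b h k * \<beta> (GenD (Abs_ipair (i, j))) (GenD (Abs_ipair (h, k))))))"
proof -
  let ?p = "\<lambda>i. - x i" and ?q = "\<lambda>i. d i + x i" and ?\<beta> = "\<lambda>u v. eval_mp \<chi> x (gen_br u v)"
  have "eval_mp \<chi> x (hbr a b) = (\<Sum>u\<in>UNIV. eval_del ?p (Poly_Mapping.lookup a u) *
    (\<Sum>v\<in>UNIV. eval_del ?q (Poly_Mapping.lookup b v) * ?\<beta> u v))"
    by (simp add: ev_hbr sum_distrib_left mult.assoc)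
  then show ?thesis
    by (simp add: sum_gen_components Let_def distrib_left sum.distrib case_prod_unfold del: gen_br.simps)
qed

end

section \<open>Values of the brackets of the free generators\<close>

lemma gen_br_XX:
  "eval_mp (\<lambda>v. vec_at d v t) x (gen_br (GenX i) (GenX j)) = - (d i + x i) * kron j t - x j * kron i t"
  "eval_mp (\<lambda>v. form_at d v h m) x (gen_br (GenX i) (GenX j)) = 0"
  by (simp_all add: algebra_simps)

lemma gen_br_XD:
  assumes "j < k"
  shows "eval_mp (\<lambda>v. vec_at d v t) x (gen_br (GenX i) (GenD (Abs_ipair (j, k)))) = 0"
    and "eval_mp (\<lambda>v. form_at d v h m) x (gen_br (GenX i) (GenD (Abs_ipair (j, k)))) =
      - (d i + x i) * (kron j h * kron k m - kron k h * kron j m)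
      + (kron i j * (x h * kron k m - x m * kron k h) - kron i k * (x h * kron j m - x m * kron j h))"
proof -
  note [simp] = Abs_ipair_inverse assms vec_eval.sum form_eval.sum
  show "eval_mp (\<lambda>v. vec_at d v t) x (gen_br (GenX i) (GenD (Abs_ipair (j, k)))) = 0"
    by simp
  show "eval_mp (\<lambda>v. form_at d v h m) x (gen_br (GenX i) (GenD (Abs_ipair (j, k)))) =
      - (d i + x i) * (kron j h * kron k m - kron k h * kron j m)
      + (kron i j * (x h * kron k m - x m * kron k h) - kron i k * (x h * kron j m - x m * kron j h))"
    by (simp add: sum_kron_pair) (simp add: kron_def algebra_simps)
qed

lemma gen_br_DX:
  assumes "j < k"
  shows "eval_mp (\<lambda>v. vec_at d v t) x (gen_br (GenD (Abs_ipair (j, k))) (GenX i)) = 0"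
    and "eval_mp (\<lambda>v. form_at d v h m) x (gen_br (GenD (Abs_ipair (j, k))) (GenX i)) =
      - x i * (kron j h * kron k m - kron k h * kron j m)
      + (kron i j * ((d h + x h) * kron k m - (d m + x m) * kron k h)
        - kron i k * ((d h + x h) * kron j m - (d m + x m) * kron j h))"
proof -
  note [simp] = Abs_ipair_inverse assms vec_eval.sum form_eval.sum
  show "eval_mp (\<lambda>v. vec_at d v t) x (gen_br (GenD (Abs_ipair (j, k))) (GenX i)) = 0"
    by simp
  show "eval_mp (\<lambda>v. form_at d v h m) x (gen_br (GenD (Abs_ipair (j, k))) (GenX i)) =
      - x i * (kron j h * kron k m - kron k h * kron j m)
      + (kron i j * ((d h + x h) * kron k m - (d m + x m) * kron k h)
        - kron i k * ((d h + x h) * kron j m - (d m + x m) * kron j h))"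
    by (simp add: sum_kron_pair) (simp add: kron_def algebra_simps)
qed

lemma gen_br_DD:
  assumes "i < j" "h < k"
  shows "eval_mp (\<lambda>v. vec_at d v t) x (gen_br (GenD (Abs_ipair (i, j))) (GenD (Abs_ipair (h, k)))) =
      (if distinct [i, j, h, k, t] then of_int (sign5 i j h k t) else 0)"
    and "eval_mp (\<lambda>v. form_at d v l m) x (gen_br (GenD (Abs_ipair (i, j))) (GenD (Abs_ipair (h, k)))) = 0"
proof -
  have *: "gen_br (GenD (Abs_ipair (i, j))) (GenD (Abs_ipair (h, k))) =
    (if distinct [i, j, h, k] then of_int (sign5 i j h k (THE t. t \<notin> {i, j, h, k})) \<cdot> dx (THE t. t \<notin> {i, j, h, k}) else 0)"
    by (simp add: Abs_ipair_inverse assms Let_def)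
  show "eval_mp (\<lambda>v. form_at d v l m) x (gen_br (GenD (Abs_ipair (i, j))) (GenD (Abs_ipair (h, k)))) = 0"
    unfolding * by simp
  show "eval_mp (\<lambda>v. vec_at d v t) x (gen_br (GenD (Abs_ipair (i, j))) (GenD (Abs_ipair (h, k)))) =
      (if distinct [i, j, h, k, t] then of_int (sign5 i j h k t) else 0)"
  proof (cases "distinct [i, j, h, k]")
    case True
    \<comment> \<open>Four distinct indices leave exactly one other, which is what the definite
      description in \<open>gen_br\<close> selects.\<close>
    then have "card {i, j, h, k} = 4" by simp
    then have "card (- {i, j, h, k}) = 1" by (simp add: Compl_eq_Diff_UNIV card_Diff_subset)
    then obtain s where s: "- {i, j, h, k} = {s}" by (rule card_1_singletonE)
    then have e: "r \<notin> {i, j, h, k} \<longleftrightarrow> r = s" for r by blast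
    then have "distinct [i, j, h, k, t] \<longleftrightarrow> t = s" using True by auto
    then show ?thesis unfolding * e using True by (simp add: kron_def)
  next
    case False
    then show ?thesis unfolding * by auto
  qed
qed

text \<open>Both sides involve only entries at increasing index pairs; for each \<open>t\<close>,
  sorting the signs produces those written in \<open>wedge\<close>.\<close>

lemma wedge_sum:
  fixes w v :: "5 \<Rightarrow> 5 \<Rightarrow> 'a::comm_ring_1"
  shows "(\<Sum>(i, j) | i < j. w i j * (\<Sum>(h, k) | h < k. v h k *
      (if distinct [i, j, h, k, t] then of_int (sign5 i j h k t) else 0))) = wedge w v t"
  by (cases t rule: cases5)
    (simp_all only: sum_pairs5, simp_all add: wedge_def wedge_coeff_def sign5_sort sign5_id algebra_simps)

lemma sum_pairs_cong:
  "(\<And>j k. j < k \<Longrightarrow> F j k = G j k) \<Longrightarrow> (\<Sum>(j, k) | j < k. F j k) = (\<Sum>(j, k) | j < (k::5). G j k)"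
  by (rule sum.cong) auto

text \<open>The first two terms are minus the commutator of the two vector fields with exponential
  factors; the last is the product of the odd parts.\<close>

lemma vec_eval_hbr:
  "eval_mp (\<lambda>v. vec_at d v t) x (hbr a b) =
    (let p = (\<lambda>i. - x i); q = (\<lambda>i. d i + x i) in
      inner5 (vec_at q b) p * vec_at p a t - inner5 (vec_at p a) q * vec_at q b t + wedge (form_at p a) (form_at q b) t)"
proof -
  let ?p = "\<lambda>i. - x i" and ?q = "\<lambda>i. d i + x i"
  have 1: "(\<Sum>i\<in>UNIV. A i * (\<Sum>j\<in>UNIV. B j * (- (d i + x i) * kron j t - x j * kron i t))) =
    inner5 B ?p * A t - inner5 A ?q * B t" for A B
    by (simp add: inner5_def right_diff_distrib sum_subtractf flip: mult.assoc sum_distrib_right)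
      (simp add: algebra_simps sum_distrib_left sum_negf sum.distrib)
  show ?thesis
    unfolding vec_at.ev_hbr_components Let_def
    by (simp only: gen_br_XX gen_br_XD gen_br_DX gen_br_DD 1 wedge_sum cong: sum_pairs_cong) simp
qed

text \<open>An even first argument acts on 2-forms by minus the Lie derivative; the other term has
  the opposite sign, with the roles of the arguments exchanged.\<close>

lemma form_eval_hbr:
  "eval_mp (\<lambda>v. form_at d v h m) x (hbr a b) =
    (let p = (\<lambda>i. - x i); q = (\<lambda>i. d i + x i) in
      lie_deriv q p (vec_at q b) (form_at p a) h m - lie_deriv p q (vec_at p a) (form_at q b) h m)"
proof -
  let ?p = "\<lambda>i. - x i" and ?q = "\<lambda>i. d i + x i"
  \<comment> \<open>Summing against the elementary 2-forms of the generators, \<open>1\<close>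
    recovers the entry of \<open>w\<close> and \<open>2\<close> yields the two terms that become
    contractions in the Lie derivative.\<close>
  have 1: "(\<Sum>(j, k) | j < k. w j k * (kron j h * kron k m - kron k h * kron j m)) = w h m"
    if "alternating w" for w :: "5 \<Rightarrow> 5 \<Rightarrow> 'a"
    by (subst sum_pairs_antisym[OF that]) (simp flip: mult.assoc)
  have 2: "(\<Sum>(j, k) | j < k. w j k * (kron i j * (c * kron k m - e * kron k h) - kron i k * (c * kron j m - e * kron j h))) =
    c * w i m - e * w i h"
    if "alternating w" for w :: "5 \<Rightarrow> 5 \<Rightarrow> 'a" and c e i
    by (subst sum_pairs_antisym[OF that])
      (simp add: sum_kron_pair mult.left_commute[of _ "kron _ _"] right_diff_distrib sum_subtractf flip: sum_distrib_left,
        simp flip: mult.assoc)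
  have lin: "(\<Sum>(j, k) | j < k. w j k * (r * U j k + V j k)) =
    r * (\<Sum>(j, k) | j < k. w j k * U j k) + (\<Sum>(j, k) | j < k. w j k * V j k)"
    for w U V :: "5 \<Rightarrow> 5 \<Rightarrow> 'a" and r
    by (simp add: algebra_simps sum.distrib sum_distrib_left case_prod_unfold)
  have XD: "(\<Sum>i\<in>UNIV. A i * (\<Sum>(j, k) | j < k. w j k * (- (d i + x i) * (kron j h * kron k m - kron k h * kron j m)
      + (kron i j * (x h * kron k m - x m * kron k h) - kron i k * (x h * kron j m - x m * kron j h))))) =
    - lie_deriv ?p ?q A w h m" if "alternating w" for A w
    unfolding lin 1[OF that] 2[OF that]
    by (simp add: lie_deriv_def inner5_def contract_def sum_distrib_left sum_distrib_right algebra_simps sum.distrib sum_subtractf sum_negf)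
  have swap: "(\<Sum>(j, k) | j < k. w j k * (\<Sum>i\<in>UNIV. B i * F i j k)) =
    (\<Sum>i\<in>UNIV. B i * (\<Sum>(j, k) | j < k. w j k * F i j k))"
    for w :: "5 \<Rightarrow> 5 \<Rightarrow> 'a" and B :: "5 \<Rightarrow> 'a" and F
    by (simp add: sum_distrib_left case_prod_unfold algebra_simps) (rule sum.swap)
  have DX: "(\<Sum>(j, k) | j < k. w j k * (\<Sum>i\<in>UNIV. B i * (- x i * (kron j h * kron k m - kron k h * kron j m)
      + (kron i j * ((d h + x h) * kron k m - (d m + x m) * kron k h)
        - kron i k * ((d h + x h) * kron j m - (d m + x m) * kron j h))))) =
    lie_deriv ?q ?p B w h m" if "alternating w" for B w
    unfolding swap lin 1[OF that] 2[OF that]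
    by (simp add: lie_deriv_def inner5_def contract_def sum_distrib_left sum_distrib_right algebra_simps sum.distrib sum_subtractf sum_negf)
  show ?thesis
    unfolding form_at.ev_hbr_components Let_def
    by (simp only: gen_br_XX gen_br_XD gen_br_DX gen_br_DD XD DX alternating_form_at cong: sum_pairs_cong) simp
qed

section \<open>The Jacobi identity at a point\<close>

text \<open>In these two formulas \<open>p = - \<lambda>\<close> and \<open>q = \<partial> + \<lambda>\<close> are the values of \<open>\<partial>\<close> on the two arguments.\<close>

definition br_vec where
  "br_vec p q A w B v t = inner5 B p * A t - inner5 A q * B t + wedge w v t"

definition br_form where
  "br_form p q A w B v j k = lie_deriv q p B w j k - lie_deriv p q A v j k"

section \<open>Multilinearity and the calculus of contractions and Lie derivatives\<close>

lemma inner5_linear: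
  "inner5 (\<lambda>i. A i + B i) q = inner5 A q + inner5 B q" "inner5 (\<lambda>i. A i - B i) q = inner5 A q - inner5 B q"
  "inner5 (\<lambda>i. - A i) q = - inner5 A q" "inner5 (\<lambda>i. c * A i) q = c * inner5 A q" "inner5 (\<lambda>i. A i * c) q = inner5 A q * c" "inner5 (\<lambda>i. 0) q = 0"
  "inner5 A (\<lambda>i. q i + r i) = inner5 A q + inner5 A r" "inner5 A (\<lambda>i. q i - r i) = inner5 A q - inner5 A r"
  "inner5 A (\<lambda>i. - q i) = - inner5 A q" "inner5 A (\<lambda>i. c * q i) = c * inner5 A q" "inner5 A (\<lambda>i. 0) = 0"
  by (simp_all add: inner5_def algebra_simps sum.distrib sum_subtractf sum_negf sum_distrib_left)

lemma contract_linear: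
  "contract (\<lambda>i. A i + B i) w k = contract A w k + contract B w k" "contract (\<lambda>i. A i - B i) w k = contract A w k - contract B w k"
  "contract (\<lambda>i. - A i) w k = - contract A w k" "contract (\<lambda>i. c * A i) w k = c * contract A w k" "contract (\<lambda>i. A i * c) w k = contract A w k * c" "contract (\<lambda>i. 0) w k = 0"
  "contract A (\<lambda>i j. w i j + v i j) k = contract A w k + contract A v k" "contract A (\<lambda>i j. w i j - v i j) k = contract A w k - contract A v k"
  "contract A (\<lambda>i j. - w i j) k = - contract A w k" "contract A (\<lambda>i j. c * w i j) k = c * contract A w k" "contract A (\<lambda>i j. 0) k = 0"
  by (simp_all add: contract_def algebra_simps sum.distrib sum_subtractf sum_negf sum_distrib_left)

lemma wedge_linear:
  "wedge (\<lambda>i j. w i j + w' i j) v t = wedge w v t + wedge w' v t"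
  "wedge (\<lambda>i j. w i j - w' i j) v t = wedge w v t - wedge w' v t"
  "wedge (\<lambda>i j. - w i j) v t = - wedge w v t" "wedge (\<lambda>i j. c * w i j) v t = c * wedge w v t"
  "wedge (\<lambda>i j. 0) v t = 0"
  "wedge v (\<lambda>i j. w i j + w' i j) t = wedge v w t + wedge v w' t"
  "wedge v (\<lambda>i j. w i j - w' i j) t = wedge v w t - wedge v w' t"
  "wedge v (\<lambda>i j. - w i j) t = - wedge v w t" "wedge v (\<lambda>i j. c * w i j) t = c * wedge v w t"
  "wedge v (\<lambda>i j. 0) t = 0"
  by (simp_all add: wedge_def wedge_coeff_def algebra_simps)

lemma lie_deriv_linear:
  "lie_deriv p q (\<lambda>i. A i + B i) w j k = lie_deriv p q A w j k + lie_deriv p q B w j k"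
  "lie_deriv p q (\<lambda>i. A i - B i) w j k = lie_deriv p q A w j k - lie_deriv p q B w j k"
  "lie_deriv p q (\<lambda>i. - A i) w j k = - lie_deriv p q A w j k"
  "lie_deriv p q (\<lambda>i. c * A i) w j k = c * lie_deriv p q A w j k"
  "lie_deriv p q (\<lambda>i. A i * c) w j k = lie_deriv p q A w j k * c"
  "lie_deriv p q (\<lambda>i. 0) w = (\<lambda>j k. 0)"
  "lie_deriv p q A (\<lambda>i j. w i j + v i j) j k = lie_deriv p q A w j k + lie_deriv p q A v j k"
  "lie_deriv p q A (\<lambda>i j. w i j - v i j) j k = lie_deriv p q A w j k - lie_deriv p q A v j k"
  "lie_deriv p q A (\<lambda>i j. - w i j) j k = - lie_deriv p q A w j k"
  "lie_deriv p q A (\<lambda>i j. c * w i j) j k = c * lie_deriv p q A w j k"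
  "lie_deriv p q A (\<lambda>i j. 0) = (\<lambda>j k. 0)"
  by (simp_all add: lie_deriv_def[abs_def] inner5_linear contract_linear algebra_simps)

lemma wedge_commute: "wedge w v t = wedge v w t"
  by (simp add: wedge_def wedge_coeff_def algebra_simps)

text \<open>The left side is the value of the form \<open>w\<close> on the pair \<open>B\<close>,
  \<open>A\<close>.\<close>

lemma inner5_contract_swap:
  assumes "alternating w"
  shows "inner5 A (contract B w) = - inner5 B (contract A w)"
proof -
  have w: "w i j = - w j i" for i j using assms unfolding alternating_def by blast
  have "inner5 A (contract B w) = (\<Sum>i\<in>UNIV. \<Sum>j\<in>UNIV. A i * (B j * w j i))"
    by (simp add: inner5_def contract_def sum_distrib_left)
  also have "\<dots> = (\<Sum>i\<in>UNIV. \<Sum>j\<in>UNIV. - (B j * (A i * w i j)))"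
    by (subst w) (simp add: algebra_simps)
  also have "\<dots> = - (\<Sum>i\<in>UNIV. \<Sum>j\<in>UNIV. B j * (A i * w i j))"
    by (simp add: sum_negf)
  also have "(\<Sum>i\<in>UNIV. \<Sum>j\<in>UNIV. B j * (A i * w i j)) = inner5 B (contract A w)"
    by (subst sum.swap) (simp add: inner5_def contract_def sum_distrib_left)
  finally show ?thesis .
qed

lemma contract_lie_deriv: "contract A (lie_deriv q r B u) k = inner5 B r * contract A u k + inner5 A q * contract B u k - q k * inner5 A (contract B u)"
proof -
  have "(\<Sum>n\<in>UNIV. \<Sum>h\<in>UNIV. A h * (B n * (q h * u n k))) = (\<Sum>h\<in>UNIV. \<Sum>n\<in>UNIV. A h * (B n * (q h * u n k)))"
    by (rule sum.swap)
  then show ?thesis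
    by (simp add: lie_deriv_def contract_def inner5_def algebra_simps sum.distrib sum_subtractf sum_distrib_left sum_distrib_right)
qed

lemma lie_deriv_lie_deriv:
  "lie_deriv p s A (lie_deriv q r B u) j k = inner5 A s * lie_deriv q r B u j k
    + p j * (inner5 B r * contract A u k + inner5 A q * contract B u k - q k * inner5 A (contract B u))
    - p k * (inner5 B r * contract A u j + inner5 A q * contract B u j - q j * inner5 A (contract B u))"
  unfolding lie_deriv_def[of p s A] contract_lie_deriv ..

text \<open>Contraction with \<open>A\<close> is an antiderivation and \<open>v\<close> has even
  degree, so the left side is p \<and> \<iota>(v \<and> u), where \<iota> contracts with
  \<open>A\<close>. For a 4-form \<omega> one has p \<and> \<iota>\<omega> = (A * p) \<omega> -
  \<iota>(p \<and> \<omega>), and the last term is a multiple of the contracted volume form, which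
  corresponds to \<open>A\<close>.\<close>

lemma wedge_exterior_contract:
  assumes "alternating v" "alternating u"
  shows "wedge (\<lambda>j k. p j * contract A v k - p k * contract A v j) u t + wedge v (\<lambda>j k. p j * contract A u k - p k * contract A u j) t
    = inner5 A p * wedge v u t - inner5 (wedge v u) p * A t"
  by (cases t rule: cases5)
    (simp_all add: wedge_def wedge_coeff_def contract_def inner5_def sum5 alternating_simps[OF assms(1)] alternating_simps[OF assms(2)] algebra_simps)

text \<open>The Leibniz rule for the Lie derivative along \<open>A\<close>. As \<open>A\<close> is
  divergence-free it preserves the volume form, so on 4-forms seen as vectors the Lie derivative is
  the commutator on the right.\<close>

lemma wedge_lie_deriv:
  assumes "alternating v" "alternating u" "inner5 A p = 0"
  shows "wedge (lie_deriv p q A v) u t + wedge v (lie_deriv p r A u) t =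
    (inner5 A q + inner5 A r) * wedge v u t - inner5 (wedge v u) p * A t"
proof -
  have "lie_deriv p q A w = (\<lambda>j k. inner5 A q * w j k + (p j * contract A w k - p k * contract A w j))" for q w
    by (simp add: lie_deriv_def fun_eq_iff)
  then show ?thesis
    using wedge_exterior_contract[OF assms(1,2), of p A t] assms(3)
    by (simp only: wedge_linear) (simp add: algebra_simps)
qed

text \<open>Paired with any vector Y, the sum is up to sign the contraction by Y of the 6-form w
  \<and> v \<and> u, which vanishes in dimension five. The proof is the coordinate
  expansion.\<close>

lemma contract_wedge_cyclic:
  assumes "alternating w" "alternating v" "alternating u"
  shows "contract (wedge v u) w k + contract (wedge w v) u k + contract (wedge w u) v k = 0"
  by (cases k rule: cases5)
    (simp_all add: wedge_def wedge_coeff_def contract_def sum5 alternating_simps[OF assms(1)] alternating_simps[OF assms(2)]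
      alternating_simps[OF assms(3)] algebra_simps)

definition closed_form where
  "closed_form p w \<longleftrightarrow> alternating w \<and> (\<forall>i j k. p i * w j k + p j * w k i + p k * w i j = 0)"

text \<open>Cartan's formula: for closed \<open>u\<close> only the exterior derivative of the
  contraction remains, and that contraction has momentum \<open>p + r\<close>. The proof contracts
  the closedness identity with \<open>A\<close>.\<close>

lemma lie_deriv_closed:
  assumes "closed_form r u"
  shows "lie_deriv p r A u j k = (p j + r j) * contract A u k - (p k + r k) * contract A u j"
proof -
  have u: "u k i = - u i k" for i using assms unfolding closed_form_def alternating_def by blast
  have "0 = (\<Sum>i\<in>UNIV. A i * (r i * u j k + r j * u k i + r k * u i j))"
    using assms by (simp add: closed_form_def)
  also have "\<dots> = inner5 A r * u j k - r j * contract A u k + r k * contract A u j"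
    unfolding u by (simp add: inner5_def contract_def algebra_simps sum.distrib sum_subtractf sum_distrib_left sum_distrib_right)
  finally show ?thesis by (simp add: lie_deriv_def algebra_simps)
qed

text \<open>In these names the parities are those of the first two arguments, and \<open>X\<close>
  or \<open>W\<close> marks the vector or the 2-form component; the third argument keeps both
  components. Here it is the Jacobi identity for vector fields.\<close>

lemma jacobi_even_even_X:
  "br_vec p (\<lambda>i. q i + r i) A (\<lambda>j k. 0) (br_vec q r B (\<lambda>j k. 0) C u) (br_form q r B (\<lambda>j k. 0) C u) t =
   br_vec (\<lambda>i. p i + q i) r (br_vec p q A (\<lambda>j k. 0) B (\<lambda>j k. 0)) (br_form p q A (\<lambda>j k. 0) B (\<lambda>j k. 0)) C u t +
   br_vec q (\<lambda>i. p i + r i) B (\<lambda>j k. 0) (br_vec p r A (\<lambda>j k. 0) C u) (br_form p r A (\<lambda>j k. 0) C u) t"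
  by (simp add: br_vec_def[abs_def] br_form_def[abs_def] lie_deriv_linear inner5_linear wedge_linear algebra_simps)

lemmas jacobi_unfold = br_vec_def[abs_def] br_form_def[abs_def] inner5_linear wedge_linear contract_linear lie_deriv_linear
  lie_deriv_lie_deriv add_0_left add_0_right diff_0 diff_0_right minus_zero

text \<open>Lie derivatives represent the commutator of vector fields on 2-forms; the double
  contractions cancel by antisymmetry of \<open>u\<close>.\<close>

lemma jacobi_even_even_W:
  assumes "alternating u"
  shows "br_form p (\<lambda>i. q i + r i) A (\<lambda>j k. 0) (br_vec q r B (\<lambda>j k. 0) C u) (br_form q r B (\<lambda>j k. 0) C u) j k =
   br_form (\<lambda>i. p i + q i) r (br_vec p q A (\<lambda>j k. 0) B (\<lambda>j k. 0)) (br_form p q A (\<lambda>j k. 0) B (\<lambda>j k. 0)) C u j k +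
   br_form q (\<lambda>i. p i + r i) B (\<lambda>j k. 0) (br_vec p r A (\<lambda>j k. 0) C u) (br_form p r A (\<lambda>j k. 0) C u) j k"
  apply (simp only: jacobi_unfold)
  apply (simp only: lie_deriv_def jacobi_unfold inner5_contract_swap[OF assms, of B A])
  apply (simp add: algebra_simps)
  done

text \<open>The Leibniz rule for \<open>A\<close> acting on the product of \<open>v\<close> and
  \<open>u\<close>.\<close>

lemma jacobi_even_odd_X:
  assumes "alternating v" "alternating u" "inner5 A p = 0"
  shows "br_vec p (\<lambda>i. q i + r i) A (\<lambda>j k. 0) (br_vec q r (\<lambda>i. 0) v C u) (br_form q r (\<lambda>i. 0) v C u) t =
   br_vec (\<lambda>i. p i + q i) r (br_vec p q A (\<lambda>j k. 0) (\<lambda>i. 0) v) (br_form p q A (\<lambda>j k. 0) (\<lambda>i. 0) v) C u t +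
   br_vec q (\<lambda>i. p i + r i) (\<lambda>i. 0) v (br_vec p r A (\<lambda>j k. 0) C u) (br_form p r A (\<lambda>j k. 0) C u) t"
  using wedge_lie_deriv[OF assms, of q t r]
  apply (simp only: jacobi_unfold)
  apply (simp add: algebra_simps)
  done

text \<open>Commutator of the Lie derivatives along \<open>A\<close> and \<open>C\<close>, applied
  to \<open>v\<close>.\<close>

lemma jacobi_even_odd_W:
  assumes "alternating v"
  shows "br_form p (\<lambda>i. q i + r i) A (\<lambda>j k. 0) (br_vec q r (\<lambda>i. 0) v C u) (br_form q r (\<lambda>i. 0) v C u) j k =
   br_form (\<lambda>i. p i + q i) r (br_vec p q A (\<lambda>j k. 0) (\<lambda>i. 0) v) (br_form p q A (\<lambda>j k. 0) (\<lambda>i. 0) v) C u j k +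
   br_form q (\<lambda>i. p i + r i) (\<lambda>i. 0) v (br_vec p r A (\<lambda>j k. 0) C u) (br_form p r A (\<lambda>j k. 0) C u) j k"
  apply (simp only: jacobi_unfold)
  apply (simp only: lie_deriv_def jacobi_unfold inner5_contract_swap[OF assms, of C A])
  apply (simp add: algebra_simps)
  done

text \<open>The Leibniz rule for \<open>B\<close> acting on the product of \<open>w\<close> and
  \<open>u\<close>.\<close>

lemma jacobi_odd_even_X:
  assumes "alternating w" "alternating u" "inner5 B q = 0"
  shows "br_vec p (\<lambda>i. q i + r i) (\<lambda>i. 0) w (br_vec q r B (\<lambda>j k. 0) C u) (br_form q r B (\<lambda>j k. 0) C u) t =
   br_vec (\<lambda>i. p i + q i) r (br_vec p q (\<lambda>i. 0) w B (\<lambda>j k. 0)) (br_form p q (\<lambda>i. 0) w B (\<lambda>j k. 0)) C u t +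
   br_vec q (\<lambda>i. p i + r i) B (\<lambda>j k. 0) (br_vec p r (\<lambda>i. 0) w C u) (br_form p r (\<lambda>i. 0) w C u) t"
  using wedge_lie_deriv[OF assms, of p t r]
  apply (simp only: jacobi_unfold)
  apply (simp add: algebra_simps)
  done

text \<open>Commutator of the Lie derivatives along \<open>B\<close> and \<open>C\<close>, applied
  to \<open>w\<close>.\<close>

lemma jacobi_odd_even_W:
  assumes "alternating w"
  shows "br_form p (\<lambda>i. q i + r i) (\<lambda>i. 0) w (br_vec q r B (\<lambda>j k. 0) C u) (br_form q r B (\<lambda>j k. 0) C u) j k =
   br_form (\<lambda>i. p i + q i) r (br_vec p q (\<lambda>i. 0) w B (\<lambda>j k. 0)) (br_form p q (\<lambda>i. 0) w B (\<lambda>j k. 0)) C u j k +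
   br_form q (\<lambda>i. p i + r i) B (\<lambda>j k. 0) (br_vec p r (\<lambda>i. 0) w C u) (br_form p r (\<lambda>i. 0) w C u) j k"
  apply (simp only: jacobi_unfold)
  apply (simp only: lie_deriv_def jacobi_unfold inner5_contract_swap[OF assms, of C B])
  apply (simp add: algebra_simps)
  done

text \<open>The Leibniz rule for the even part \<open>C\<close> of the third argument acting on the
  product of \<open>w\<close> and \<open>v\<close>; the minus sign is the Koszul sign.\<close>

lemma jacobi_odd_odd_X:
  assumes "alternating w" "alternating v" "inner5 C r = 0"
  shows "br_vec p (\<lambda>i. q i + r i) (\<lambda>i. 0) w (br_vec q r (\<lambda>i. 0) v C u) (br_form q r (\<lambda>i. 0) v C u) t =
   br_vec (\<lambda>i. p i + q i) r (br_vec p q (\<lambda>i. 0) w (\<lambda>i. 0) v) (br_form p q (\<lambda>i. 0) w (\<lambda>i. 0) v) C u t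
   - br_vec q (\<lambda>i. p i + r i) (\<lambda>i. 0) v (br_vec p r (\<lambda>i. 0) w C u) (br_form p r (\<lambda>i. 0) w C u) t"
  using wedge_lie_deriv[OF assms, of p t q]
  apply (simp only: jacobi_unfold)
  apply (simp add: algebra_simps wedge_commute[of v])
  done

text \<open>Each term is a Lie derivative of a closed form along a product vector. By
  \<open>lie_deriv_closed\<close> all carry the total momentum \<open>p + q + r\<close>, so the
  identity reduces to \<open>contract_wedge_cyclic\<close>.\<close>

lemma jacobi_odd_odd_W:
  assumes "closed_form p w" "closed_form q v" "closed_form r u"
  shows "br_form p (\<lambda>i. q i + r i) (\<lambda>i. 0) w (br_vec q r (\<lambda>i. 0) v C u) (br_form q r (\<lambda>i. 0) v C u) j k =
   br_form (\<lambda>i. p i + q i) r (br_vec p q (\<lambda>i. 0) w (\<lambda>i. 0) v) (br_form p q (\<lambda>i. 0) w (\<lambda>i. 0) v) C u j k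
   - br_form q (\<lambda>i. p i + r i) (\<lambda>i. 0) v (br_vec p r (\<lambda>i. 0) w C u) (br_form p r (\<lambda>i. 0) w C u) j k"
proof -
  have alt: "alternating w" "alternating v" "alternating u"
    using assms by (simp_all add: closed_form_def)
  have e: "contract (wedge v u) w i = - contract (wedge w v) u i - contract (wedge w u) v i" for i
    using contract_wedge_cyclic[OF alt, of i] by (simp add: eq_neg_iff_add_eq_0 algebra_simps)
  show ?thesis
    apply (simp only: jacobi_unfold)
    apply (simp only: lie_deriv_closed[OF assms(1)] lie_deriv_closed[OF assms(2)] lie_deriv_closed[OF assms(3)] e)
    apply (simp add: algebra_simps)
    done
qed

section \<open>The generators of \<open>RE(5,10)\<close>\<close>

lemma eval_mp_linear:
  "eval_mp (\<lambda>m. f m + g m) x P = eval_mp f x P + eval_mp g x P"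
  "eval_mp (\<lambda>m. f m - g m) x P = eval_mp f x P - eval_mp g x P"
  "eval_mp (\<lambda>m. - f m) x P = - eval_mp f x P"
  "eval_mp (\<lambda>m. c * f m) x P = c * eval_mp f x P"
  "eval_mp (\<lambda>m. f m * c) x P = eval_mp f x P * c"
  "eval_mp (\<lambda>m. \<Sum>i\<in>I. F i m) x P = (\<Sum>i\<in>I. eval_mp (F i) x P)"
  by (simp_all add: eval_mp_def algebra_simps sum.distrib sum_subtractf sum_negf sum_distrib_left sum_distrib_right)
    (rule sum.swap)

text \<open>For a fixed other argument the pointwise bracket is a linear functional of this one, so
  evaluation passes through it. This resolves the nested brackets of the Jacobi identity.\<close>

lemma eval_mp_br_right:
  "eval_mp (\<lambda>m. br_vec p q A w (B m) (v m) t) x P = br_vec p q A w (\<lambda>i. eval_mp (\<lambda>m. B m i) x P) (\<lambda>j k. eval_mp (\<lambda>m. v m j k) x P) t"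
  "eval_mp (\<lambda>m. br_form p q A w (B m) (v m) j k) x P = br_form p q A w (\<lambda>i. eval_mp (\<lambda>m. B m i) x P) (\<lambda>j k. eval_mp (\<lambda>m. v m j k) x P) j k"
  by (simp_all add: br_vec_def br_form_def lie_deriv_def inner5_def contract_def wedge_def wedge_coeff_def eval_mp_linear)

lemma eval_mp_br_left:
  "eval_mp (\<lambda>m. br_vec p q (B m) (v m) A w t) x P = br_vec p q (\<lambda>i. eval_mp (\<lambda>m. B m i) x P) (\<lambda>j k. eval_mp (\<lambda>m. v m j k) x P) A w t"
  "eval_mp (\<lambda>m. br_form p q (B m) (v m) A w j k) x P = br_form p q (\<lambda>i. eval_mp (\<lambda>m. B m i) x P) (\<lambda>j k. eval_mp (\<lambda>m. v m j k) x P) A w j k"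
  by (simp_all add: br_vec_def br_form_def lie_deriv_def inner5_def contract_def wedge_def wedge_coeff_def eval_mp_linear)

lemma hbr_components:
  "eval_mp (\<lambda>v. vec_at d v t) x (hbr a b) = br_vec (\<lambda>i. - x i) (\<lambda>i. d i + x i)
    (vec_at (\<lambda>i. - x i) a) (form_at (\<lambda>i. - x i) a) (vec_at (\<lambda>i. d i + x i) b) (form_at (\<lambda>i. d i + x i) b) t"
  "eval_mp (\<lambda>v. form_at d v h m) x (hbr a b) = br_form (\<lambda>i. - x i) (\<lambda>i. d i + x i)
    (vec_at (\<lambda>i. - x i) a) (form_at (\<lambda>i. - x i) a) (vec_at (\<lambda>i. d i + x i) b) (form_at (\<lambda>i. d i + x i) b) h m"
  by (simp_all add: vec_eval_hbr form_eval_hbr Let_def br_vec_def br_form_def)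

lemma vec_at_fun: "vec_at d (a + b) = (\<lambda>i. vec_at d a i + vec_at d b i)" "vec_at d (hscale s a) = (\<lambda>i. eval_del d s * vec_at d a i)"
  and form_at_fun: "form_at d (a + b) = (\<lambda>j k. form_at d a j k + form_at d b j k)" "form_at d (hscale s a) = (\<lambda>j k. eval_del d s * form_at d a j k)"
  by (simp_all add: fun_eq_iff)

interpretation hatRE: module hscale
  by (rule module_hscale)

section \<open>Additivity, sesquilinearity, grading and skew-symmetry\<close>

lemma hbr_add_left: "hbr (a + a') b = hbr a b + hbr a' (b :: 'a::{idom, ring_char_0} hatRE)"
  by (rule hpoly_eqI)
    (simp_all add: hbr_components vec_at_fun form_at_fun br_vec_def br_form_def inner5_linear wedge_linear lie_deriv_linear algebra_simps)

lemma hbr_add_right: "hbr a (b + b') = hbr a b + hbr a (b' :: 'a::{idom, ring_char_0} hatRE)"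
  by (rule hpoly_eqI)
    (simp_all add: hbr_components vec_at_fun form_at_fun br_vec_def br_form_def inner5_linear wedge_linear lie_deriv_linear algebra_simps)

text \<open>\<open>P\<close> is specified only by its values, namely \<open>s\<close> at minus the
  formal variables; constants, the variables \<open>\<partial>\<close> and \<open>peval\<close> are
  all instances.\<close>

lemma hbr_hscale_left:
  fixes a b :: "'a::{idom, ring_char_0} hatRE"
  assumes "\<And>d x. eval_mp (eval_del d) x P = eval_del (\<lambda>i. - x i) s"
  shows "hbr (hscale s a) b = pscale hscale P (hbr a b)"
  by (rule hpoly_eqI)
    (simp_all add: assms hbr_components vec_at_fun form_at_fun br_vec_def br_form_def inner5_linear wedge_linear lie_deriv_linear algebra_simps)

lemma hbr_hscale_right:
  fixes a b :: "'a::{idom, ring_char_0} hatRE"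
  assumes "\<And>d x. eval_mp (eval_del d) x P = eval_del (\<lambda>i. d i + x i) s"
  shows "hbr a (hscale s b) = pscale hscale P (hbr a b)"
  by (rule hpoly_eqI)
    (simp_all add: assms hbr_components vec_at_fun form_at_fun br_vec_def br_form_def inner5_linear wedge_linear lie_deriv_linear algebra_simps)

lemma hgrade_0_iff:
  fixes v :: "'a::{idom, ring_char_0} hatRE"
  shows "v \<in> hgrade 0 \<longleftrightarrow> (\<forall>d. form_at d v = (\<lambda>j k. 0))"
proof
  assume v: "v \<in> hgrade 0"
  then have "Poly_Mapping.lookup v (GenD p) = 0" for p
    by (auto simp: hgrade_def in_keys_iff)
  then show "\<forall>d. form_at d v = (\<lambda>j k. 0)" by (simp add: form_at_def fun_eq_iff)
next
  assume v: "\<forall>d. form_at d v = (\<lambda>j k. 0)"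
  have "Poly_Mapping.lookup v (GenD (Abs_ipair (j, k))) = 0" if "j < k" for j k
  proof (rule eval_del_eqI)
    fix d show "eval_del d (Poly_Mapping.lookup v (GenD (Abs_ipair (j, k)))) = eval_del d 0"
      using v[rule_format, of d, THEN fun_cong, THEN fun_cong, of j k] that by (simp add: form_at_def)
  qed
  then have "Poly_Mapping.lookup v (GenD p) = 0" for p
    by (cases p) auto
  then have "u \<in> range GenX" if "u \<in> Poly_Mapping.keys v" for u
    using that by (cases u) (auto simp: in_keys_iff)
  then show "v \<in> hgrade 0" by (auto simp: hgrade_def)
qed

lemma hgrade_1_iff:
  fixes v :: "'a::{idom, ring_char_0} hatRE"
  shows "v \<in> hgrade 1 \<longleftrightarrow> (\<forall>d. vec_at d v = (\<lambda>i. 0))"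
proof
  assume v: "v \<in> hgrade 1"
  then have "Poly_Mapping.lookup v (GenX i) = 0" for i
    by (auto simp: hgrade_def in_keys_iff)
  then show "\<forall>d. vec_at d v = (\<lambda>i. 0)" by (simp add: vec_at_def fun_eq_iff)
next
  assume v: "\<forall>d. vec_at d v = (\<lambda>i. 0)"
  have "Poly_Mapping.lookup v (GenX i) = 0" for i
  proof (rule eval_del_eqI)
    fix d show "eval_del d (Poly_Mapping.lookup v (GenX i)) = eval_del d 0"
      using v[rule_format, of d, THEN fun_cong, of i] by (simp add: vec_at_def)
  qed
  then have "u \<in> range GenD" if "u \<in> Poly_Mapping.keys v" for u
    using that by (cases u) (auto simp: in_keys_iff)
  then show "v \<in> hgrade 1" by (auto simp: hgrade_def)
qed

lemma subspace_hgrade: "hatRE.subspace (hgrade p :: 'a::{idom, ring_char_0} hatRE set)"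
  by (cases p) (auto simp: hatRE.subspace_def hgrade_0_iff hgrade_1_iff vec_at_fun form_at_fun fun_eq_iff)

lemma hbr_skew_symmetric:
  fixes a b :: "'a::{idom, ring_char_0} hatRE"
  assumes "a \<in> hgrade p" "b \<in> hgrade q"
  shows "hbr b a = - pscale hscale (koszul p q) (br_at hscale hbr (\<lambda>i. - lam i - del i) a b)"
proof -
  \<comment> \<open>The substitution of \<open>- x - d\<close> for \<open>x\<close> exchanges the
    momenta \<open>- x\<close> and \<open>d + x\<close> of the two arguments.\<close>
  have e: "(\<lambda>i. - (- x i - d i)) = (\<lambda>i. d i + x i)" "(\<lambda>i. d i + (- x i - d i)) = (\<lambda>i. - x i)"
    for d x :: "5 \<Rightarrow> 'a" by (simp_all add: fun_eq_iff)
  have k: "eval_mp (eval_del d) x (koszul p q) = koszul p q" for d x :: "5 \<Rightarrow> 'a"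
    by (simp add: koszul_def)
  show ?thesis
    using assms
    by (intro hpoly_eqI; cases p; cases q)
      (simp_all add: vec_at.ev_br_at form_at.ev_br_at k hbr_components e hgrade_0_iff hgrade_1_iff koszul_def
        br_vec_def br_form_def inner5_linear wedge_linear lie_deriv_linear wedge_commute)
qed

lemma components_a_gen [simp]:
  "vec_at d (a_gen i j) = (\<lambda>t. d i * kron j t - d j * kron i t)" "form_at d (a_gen i j) = (\<lambda>h m. 0)"
  by (simp_all add: a_gen_def fun_eq_iff)

lemma components_b_gen [simp]:
  "vec_at d (b_gen k) = (\<lambda>t. 0)" "form_at d (b_gen k) = (\<lambda>h m. d h * kron k m - d m * kron k h)"
  by (simp_all add: b_gen_def fun_eq_iff vec_at.sum form_at.sum sum_kron_pair)

lemma a_gen_in_RE: "a_gen i j \<in> RE" and b_gen_in_RE: "b_gen k \<in> RE"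
  unfolding RE_def by (auto intro: hatRE.span_base)

lemma subspace_RE: "hatRE.subspace RE"
  unfolding RE_def by (rule hatRE.subspace_span)

lemma RE_minimal:
  assumes "\<And>i j. a_gen i j \<in> S" "\<And>k. b_gen k \<in> S" "hatRE.subspace S"
  shows "RE \<subseteq> S"
  unfolding RE_def by (rule hatRE.span_minimal) (use assms in auto)

lemma a_gen_in_RE_grade: "(a_gen i j :: 'a::{idom, ring_char_0} hatRE) \<in> RE_grade 0"
  and b_gen_in_RE_grade: "(b_gen k :: 'a hatRE) \<in> RE_grade 1"
  by (simp_all add: RE_grade_def a_gen_in_RE b_gen_in_RE hgrade_0_iff hgrade_1_iff)

lemma closed_form_linear:
  "closed_form p (\<lambda>j k. 0)"
  "closed_form p w \<Longrightarrow> closed_form p v \<Longrightarrow> closed_form p (\<lambda>j k. w j k + v j k)"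
  "closed_form p w \<Longrightarrow> closed_form p (\<lambda>j k. c * w j k)"
proof -
  show "closed_form p (\<lambda>j k. 0)" by (simp add: closed_form_def alternating_def)
  assume w: "closed_form p w"
  have w': "w i j = - w j i" "w i i = 0" for i j
    using w unfolding closed_form_def alternating_def by blast+
  have w'': "p i * w j k + p j * w k i + p k * w i j = 0" for i j k
    using w unfolding closed_form_def by blast
  have "alternating (\<lambda>j k. c * w j k)"
    unfolding alternating_def using w' by (metis mult_minus_right mult_zero_right)
  moreover have "p i * (c * w j k) + p j * (c * w k i) + p k * (c * w i j) = 0" for i j k
    using arg_cong[OF w''[of i j k], of "(*) c"] by (simp add: algebra_simps)
  ultimately show "closed_form p (\<lambda>j k. c * w j k)" unfolding closed_form_def by blast
  assume v: "closed_form p v"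
  have v': "v i j = - v j i" "v i i = 0" for i j
    using v unfolding closed_form_def alternating_def by blast+
  have v'': "p i * v j k + p j * v k i + p k * v i j = 0" for i j k
    using v unfolding closed_form_def by blast
  have "alternating (\<lambda>j k. w j k + v j k)"
    unfolding alternating_def using w' v' by (metis add.inverse_distrib_swap add.commute add_0)
  moreover have "p i * (w j k + v j k) + p j * (w k i + v k i) + p k * (w i j + v i j) = 0" for i j k
    using arg_cong2[OF w''[of i j k] v''[of i j k], of "(+)"] by (simp add: algebra_simps)
  ultimately show "closed_form p (\<lambda>j k. w j k + v j k)" unfolding closed_form_def by blast
qed

text \<open>At momentum \<open>p\<close> the generator \<open>b_gen k\<close> becomes the product of
  \<open>p\<close> with the k-th coordinate covector, whose product with \<open>p\<close> is zero;
  for \<open>a_gen i j\<close> the divergence is \<open>p i * p j - p j * p i\<close>. Both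
  conditions are preserved by sums and multiples.\<close>

lemma RE_components:
  assumes "a \<in> RE"
  shows "inner5 (vec_at p a) p = 0" "closed_form p (form_at p a)"
proof -
  have inner5_kron: "inner5 (kron i) q = q i" for i and q :: "5 \<Rightarrow> 'a" by (simp add: inner5_def)
  have "RE \<subseteq> {a. inner5 (vec_at p a) p = 0 \<and> closed_form p (form_at p a)}"
  proof (rule RE_minimal)
    show "a_gen i j \<in> {a. inner5 (vec_at p a) p = 0 \<and> closed_form p (form_at p a)}" for i j
      by (simp add: closed_form_linear inner5_linear inner5_kron algebra_simps)
    show "b_gen k \<in> {a. inner5 (vec_at p a) p = 0 \<and> closed_form p (form_at p a)}" for k
      by (simp add: closed_form_def inner5_linear alternating_def algebra_simps)
    show "hatRE.subspace {a. inner5 (vec_at p a) p = 0 \<and> closed_form p (form_at p a)}"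
    proof (rule hatRE.subspaceI)
      have "vec_at p 0 = (\<lambda>i. 0)" "form_at p 0 = (\<lambda>j k. 0)" by (simp_all add: fun_eq_iff)
      then show "0 \<in> {a. inner5 (vec_at p a) p = 0 \<and> closed_form p (form_at p a)}"
        by (simp add: inner5_linear closed_form_linear)
    qed (auto simp: vec_at_fun form_at_fun inner5_linear intro: closed_form_linear)
  qed
  with assms show "inner5 (vec_at p a) p = 0" "closed_form p (form_at p a)" by auto
qed

section \<open>Brackets of the generators of \<open>RE\<close>\<close>

lemma hbr_a_a:
  fixes i j r s :: 5
  shows "hbr (a_gen i j :: 'a::{idom, ring_char_0} hatRE) (a_gen r s) =
        (lam j * lam r) \<cdot> a_gen s i + (lam i * lam r) \<cdot> a_gen j s
        + (lam i * lam s) \<cdot> a_gen r j + (lam j * lam s) \<cdot> a_gen i r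
        + (lam i * del j) \<cdot> a_gen r s + (lam j * del i) \<cdot> a_gen s r"
proof -
  have inner5_kron: "inner5 (kron i) q = q i" for i and q :: "5 \<Rightarrow> 'a" by (simp add: inner5_def)
  show ?thesis
    by (rule hpoly_eqI)
      (simp_all add: hbr_components br_vec_def br_form_def inner5_linear wedge_linear lie_deriv_linear inner5_kron algebra_simps)
qed

lemma hbr_a_b:
  "hbr (a_gen i j :: 'a::{idom, ring_char_0} hatRE) (b_gen k) =
        (lam i * del j - lam j * del i) \<cdot> b_gen k
        + pscale hscale ((if i = k then lam j else 0) - (if j = k then lam i else 0))
            (\<Sum>r\<in>UNIV. lam r \<cdot> b_gen r)"
proof -
  have inner5_kron: "inner5 (kron i) q = q i" "contract (kron i) w k = w i k" for i k w and q :: "5 \<Rightarrow> 'a"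
    by (simp_all add: inner5_def contract_def)
  have s: "(\<Sum>r\<in>UNIV. x r * (c * kron r m - e * kron r h)) = c * x m - e * x h"
    for c e h m and x :: "5 \<Rightarrow> 'a"
    using sum_kron_pair[of x m c h e] by (simp add: algebra_simps)
  have if_eq: "(if i = k then c else 0) = kron i k * c" for i k and c :: 'a by (simp add: kron_def)
  have if_ev: "eval_mp (eval_del d) x (if b then c else 0) = (if b then eval_mp (eval_del d) x c else 0)" for d x :: "5 \<Rightarrow> 'a" and b c
    by simp
  have sym: "kron k i = kron i k" for i k by (simp add: kron_def)
  show ?thesis
    by (rule hpoly_eqI)
      (simp_all add: hbr_components br_vec_def br_form_def inner5_linear wedge_linear lie_deriv_linear vec_eval.sum form_eval.sum s if_ev if_eq,
       simp add: lie_deriv_def inner5_kron inner5_linear contract_linear sym[of k] algebra_simps)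
qed

text \<open>The two 2-forms have the i-th coordinate covector as a common factor, so their product
  vanishes.\<close>

lemma hbr_b_b_same: "hbr (b_gen i :: 'a::{idom, ring_char_0} hatRE) (b_gen i) = 0"
proof (rule hpoly_eqI)
  fix d x :: "5 \<Rightarrow> 'a" and t
  show "eval_mp (\<lambda>v. vec_at d v t) x (hbr (b_gen i) (b_gen i)) = eval_mp (\<lambda>v. vec_at d v t) x 0"
    by (cases t rule: cases5; cases i rule: cases5)
      (simp_all add: hbr_components br_vec_def inner5_linear wedge_def wedge_coeff_def kron_def algebra_simps)
qed (simp add: hbr_components br_form_def lie_deriv_linear)

lemma hbr_b_b:
  assumes "i \<noteq> j" "{i, j, h, k, l} = (UNIV :: 5 set)"
  shows "hbr (b_gen i :: 'a::{idom, ring_char_0} hatRE) (b_gen j) =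
        pscale hscale (of_int (sign5 i j h k l))
          (lam h \<cdot> a_gen k l + lam k \<cdot> a_gen l h + lam l \<cdot> a_gen h k)"
proof (rule hpoly_eqI)
  fix d x :: "5 \<Rightarrow> 'a" and t
  \<comment> \<open>The 2-forms of \<open>b_gen i\<close> at \<open>- x\<close> and of
    \<open>b_gen j\<close> at \<open>d + x\<close>.\<close>
  let ?w = "\<lambda>h m. - x h * kron i m - - x m * kron i h" and ?v = "\<lambda>h m. (d h + x h) * kron j m - (d m + x m) * kron j h"
  have alt: "alternating ?w" "alternating ?v" by (simp_all add: alternating_def)
  have "card {i, j, h, k, l} = 5" by (simp add: assms)
  then have "card (set [i, j, h, k, l]) = length [i, j, h, k, l]" by simp
  then have dist: "distinct [i, j, h, k, l]" by (rule card_distinct)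
  then have cyc: "distinct [i, j, k, l, h]" "distinct [i, j, l, h, k]" "distinct [j, h, k, l, i]" "distinct [i, h, k, l, j]"
    "distinct [i, j, k, h, l]" and rev: "distinct [l, k, h, j, i]"
    by auto
  \<comment> \<open>A cyclic rotation of the last three entries is even.\<close>
  have sgn: "sign5 i j k l h = sign5 i j h k l" "sign5 i j l h k = sign5 i j h k l"
    using sign5_swap(3)[OF dist] sign5_swap(4)[OF cyc(5)] sign5_swap(4)[OF dist]  sign5_swap(3)[of i j h l k] dist by auto
  \<comment> \<open>In the product the \<open>x\<close> part of \<open>d + x\<close> cancels against
    the factor \<open>x\<close> of \<open>?w\<close>. The component at \<open>t\<close> belongs to
    the four other indices: it vanishes for \<open>t = i\<close> and \<open>t = j\<close>, where a
    covector is missing, and is otherwise a 2 by 2 minor of \<open>x\<close> and \<open>d\<close> up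
    to sign.\<close>
  have w: "wedge ?w ?v t = of_int (sign5 i j h k l) * (x h * (d k * kron l t - d l * kron k t) +
     x k * (d l * kron h t - d h * kron l t) + x l * (d h * kron k t - d k * kron h t))"
  proof -
    have "t \<in> {i, j, h, k, l}" using assms by simp
    then consider "t = i" | "t = j" | "t = h" | "t = k" | "t = l" by auto
    then show ?thesis
    proof cases
      case 1
      then show ?thesis unfolding 1 wedge_eq_wedge_coeff[OF alt cyc(3)] using dist rev by (simp add: wedge_coeff_def kron_def)
    next
      case 2
      then show ?thesis unfolding 2 wedge_eq_wedge_coeff[OF alt cyc(4)] using dist rev by (simp add: wedge_coeff_def kron_def)
    next
      case 3
      then show ?thesis unfolding 3 wedge_eq_wedge_coeff[OF alt cyc(1)] using dist rev
        by (simp add: sgn wedge_coeff_def kron_def) (simp add: algebra_simps)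
    next
      case 4
      then show ?thesis unfolding 4 wedge_eq_wedge_coeff[OF alt cyc(2)] using dist rev
        by (simp add: sgn wedge_coeff_def kron_def) (simp add: algebra_simps)
    next
      case 5
      then show ?thesis unfolding 5 wedge_eq_wedge_coeff[OF alt dist] using dist rev
        by (simp add: wedge_coeff_def kron_def) (simp add: algebra_simps)
    qed
  qed
  show "eval_mp (\<lambda>v. vec_at d v t) x (hbr (b_gen i) (b_gen j)) = eval_mp (\<lambda>v. vec_at d v t) x (pscale hscale (of_int (sign5 i j h k l))
          (lam h \<cdot> a_gen k l + lam k \<cdot> a_gen l h + lam l \<cdot> a_gen h k))"
    unfolding hbr_components components_b_gen br_vec_def w by (simp add: inner5_linear)
qed (simp add: hbr_components br_form_def lie_deriv_linear)

section \<open>The Lie conformal superalgebra axioms\<close>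

lemma lookup_pscale_closed:
  assumes "module scale" "module.subspace scale R" "\<And>n. Poly_Mapping.lookup P n \<in> R"
  shows "Poly_Mapping.lookup (pscale scale p P) n \<in> R"
proof -
  interpret module scale by fact
  show ?thesis
    unfolding pscale_def lookup_sum lookup_single
    by (intro subspace_sum assms(2)) (auto simp: when_def intro: subspace_scale subspace_0 assms)
qed

lemma lookup_psubst_closed:
  assumes "module scale" "module.subspace scale R" "\<And>n k. Poly_Mapping.lookup (\<theta> (Poly_Mapping.lookup P n)) k \<in> R"
  shows "Poly_Mapping.lookup (psubst scale \<sigma> \<theta> P) n \<in> R"
proof -
  interpret module scale by fact
  show ?thesis
    unfolding psubst_def lookup_sum
    by (intro subspace_sum lookup_pscale_closed assms)
qed

lemma lookup_pconst_closed:
  assumes "module scale" "module.subspace scale R" "c \<in> R"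
  shows "Poly_Mapping.lookup (pconst c) n \<in> R"
proof -
  interpret module scale by fact
  show ?thesis using assms subspace_0[OF assms(2)] by (simp add: pconst_def lookup_single when_def)
qed

definition RE_poly :: "(5, 'a::comm_ring_1 hatRE) mpoly \<Rightarrow> bool"
  where "RE_poly P \<longleftrightarrow> (\<forall>n. Poly_Mapping.lookup P n \<in> RE)"

lemma RE_poly_intros:
  "RE_poly 0"
  "RE_poly P \<Longrightarrow> RE_poly Q \<Longrightarrow> RE_poly (P + Q)"
  "RE_poly P \<Longrightarrow> RE_poly (- P)"
  "(\<And>i. i \<in> I \<Longrightarrow> RE_poly (F i)) \<Longrightarrow> RE_poly (sum F I)"
  "RE_poly P \<Longrightarrow> RE_poly (pscale hscale p P)"
  "v \<in> RE \<Longrightarrow> RE_poly (p \<cdot> v)"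
  unfolding RE_poly_def hterm_def lookup_add lookup_uminus lookup_zero lookup_sum
  by (intro allI lookup_pscale_closed[OF module_hscale subspace_RE] lookup_pconst_closed[OF module_hscale subspace_RE]
      subspace_RE hatRE.subspace_0 hatRE.subspace_add hatRE.subspace_neg hatRE.subspace_sum; blast)+

lemma RE_poly_br_at:
  assumes "RE_poly (br a b)"
  shows "RE_poly (br_at hscale br \<sigma> a b)"
  using assms unfolding RE_poly_def br_at_def
  by (intro allI lookup_psubst_closed[OF module_hscale subspace_RE] lookup_pconst_closed[OF module_hscale subspace_RE])
    blast

lemma RE_poly_hbr_b_b: "RE_poly (hbr (b_gen i) (b_gen j :: 'a::{idom, ring_char_0} hatRE))"
proof (cases "i = j")
  case False
  then have "card (- {i, j}) = 3" by (simp add: Compl_eq_Diff_UNIV card_Diff_subset)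
  then obtain h k l where "- {i, j} = {h, k, l}" by (auto simp: card_3_iff)
  then have *: "{i, j, h, k, l} = UNIV" by blast
  show ?thesis
    unfolding hbr_b_b[OF False *] by (intro RE_poly_intros a_gen_in_RE)
qed (simp add: hbr_b_b_same RE_poly_intros)

lemma RE_poly_hbr_gen:
  fixes u v :: "'a::{idom, ring_char_0} hatRE"
  assumes "u \<in> {a_gen i j |i j. True} \<union> {b_gen k |k. True}" "v \<in> {a_gen i j |i j. True} \<union> {b_gen k |k. True}"
  shows "RE_poly (hbr u v)"
proof -
  have ab: "RE_poly (hbr (a_gen i j) (b_gen k :: 'a hatRE))" for i j k
    unfolding hbr_a_b by (intro RE_poly_intros b_gen_in_RE)
  \<comment> \<open>The bracket in this order is obtained from \<open>ab\<close> by
    skew-symmetry.\<close>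
  have "RE_poly (hbr (b_gen k) (a_gen i j :: 'a hatRE))" for i j k
    by (subst hbr_skew_symmetric[of "a_gen i j" 0 "b_gen k" 1])
      (use a_gen_in_RE_grade b_gen_in_RE_grade in \<open>auto simp: RE_grade_def intro!: RE_poly_intros RE_poly_br_at ab\<close>)
  moreover have "RE_poly (hbr (a_gen i j) (a_gen r s :: 'a hatRE))" for i j r s
    unfolding hbr_a_a by (intro RE_poly_intros a_gen_in_RE)
  ultimately show ?thesis
    using assms ab RE_poly_hbr_b_b by blast
qed

lemma hbr_zero: "hbr 0 b = 0" "hbr a 0 = 0"
  by (simp_all add: hbr_def)

lemma eval_lam_del_peval_left: "eval_mp (eval_del d) x (peval (\<lambda>i. - lam i) s) = eval_del (\<lambda>i. - x i) s"
  and eval_lam_del_peval_right: "eval_mp (eval_del d) x (peval (\<lambda>i. del i + lam i) s) = eval_del (\<lambda>i. d i + x i) s"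
  by (simp_all add: eval_lam_del_peval)

text \<open>Two extensions by minimality of the span: first the left argument runs over
  \<open>RE\<close> with a generator on the right, then the right argument runs over
  \<open>RE\<close>. Sesquilinearity, with explicit polynomials given by \<open>peval\<close>, makes
  the sets involved submodules.\<close>

lemma RE_poly_hbr:
  fixes a b :: "'a::{idom, ring_char_0} hatRE"
  assumes "a \<in> RE" "b \<in> RE"
  shows "RE_poly (hbr a b)"
proof -
  define G where "G = ({a_gen i j |i j. True} \<union> {b_gen k |k. True} :: 'a hatRE set)"
  have gen: "RE_poly (hbr u v)" if "u \<in> G" "v \<in> G" for u v
    using that RE_poly_hbr_gen unfolding G_def by blast
  have G: "a_gen i j \<in> G" "b_gen k \<in> G" for i j k unfolding G_def by blast+
  have 1: "RE \<subseteq> {a. \<forall>v\<in>G. RE_poly (hbr a v)}"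
  proof (rule RE_minimal)
    show "hatRE.subspace {a. \<forall>v\<in>G. RE_poly (hbr a v)}"
      by (rule hatRE.subspaceI)
        (auto simp: hbr_zero hbr_add_left hbr_hscale_left[OF eval_lam_del_peval_left] intro!: RE_poly_intros)
  qed (use gen G in blast)+
  have "RE \<subseteq> {b. \<forall>a\<in>RE. RE_poly (hbr a (b :: 'a hatRE))}"
  proof (rule RE_minimal)
    show "hatRE.subspace {b. \<forall>a\<in>RE. RE_poly (hbr a (b :: 'a hatRE))}"
      by (rule hatRE.subspaceI)
        (auto simp: hbr_zero hbr_add_right hbr_hscale_right[OF eval_lam_del_peval_right] intro!: RE_poly_intros)
  qed (use 1 G in blast)+
  with assms show ?thesis by blast
qed

section \<open>Parity and the Jacobi identity\<close>

lemma hbr_parity: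
  fixes a b :: "'a::{idom, ring_char_0} hatRE"
  assumes "a \<in> hgrade p" "b \<in> hgrade q"
  shows "Poly_Mapping.lookup (hbr a b) n \<in> hgrade (p + q)"
proof (cases "p = q")
  case True
  then have "p + q = 0" by (cases q) simp_all
  moreover have "form_at d (Poly_Mapping.lookup (hbr a b) n) j k = 0" for d j k
  proof (rule eval_mp_eq_0_imp[where \<phi> = "\<lambda>v. form_at d v j k"])
    show "eval_mp (\<lambda>v. form_at d v j k) x (hbr a b) = 0" for x
      using assms True
      by (cases p; cases q) (simp_all add: hgrade_0_iff hgrade_1_iff hbr_components br_form_def lie_deriv_linear)
  qed simp
  ultimately show ?thesis by (simp add: hgrade_0_iff fun_eq_iff)
next
  case False
  then have "p + q = 1" by (cases p; cases q) simp_all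
  moreover have "vec_at d (Poly_Mapping.lookup (hbr a b) n) i = 0" for d i
  proof (rule eval_mp_eq_0_imp[where \<phi> = "\<lambda>v. vec_at d v i"])
    show "eval_mp (\<lambda>v. vec_at d v i) x (hbr a b) = 0" for x
      using assms False
      by (cases p; cases q) (simp_all add: hgrade_0_iff hgrade_1_iff hbr_components br_vec_def wedge_linear inner5_linear)
  qed simp
  ultimately show ?thesis by (simp add: hgrade_1_iff fun_eq_iff)
qed

lemma hbr_jacobi:
  fixes a b c :: "'a::{idom, ring_char_0} hatRE"
  assumes a: "a \<in> RE_grade p" and b: "b \<in> RE_grade q" and c: "c \<in> RE"
  shows "psubst hscale mu2 (\<lambda>x. br_at hscale hbr lam2 a x) (hbr b c) =
      psubst hscale lam2 (\<lambda>x. br_at hscale hbr (\<lambda>i. lam2 i + mu2 i) x c) (hbr a b) +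
      pscale hscale (koszul p q) (psubst hscale lam2 (\<lambda>x. br_at hscale hbr mu2 b x) (hbr a c))"
proof -
  have k: "eval_mp (eval_del d) x (koszul p q) = koszul p q" for d :: "5 \<Rightarrow> 'a" and x :: "5 + 5 \<Rightarrow> 'a"
    by (simp add: koszul_def)
  have RE: "a \<in> RE" "b \<in> RE" using a b by (simp_all add: RE_grade_def)
  \<comment> \<open>\<open>P = -\<lambda>\<close>, \<open>Q = -\<mu>\<close>, \<open>R = \<partial> + \<lambda> + \<mu>\<close> are the values of \<open>\<partial>\<close> on \<open>a\<close>, \<open>b\<close>, \<open>c\<close> respectively.\<close>
  have momenta: "(\<lambda>i. d i + y (Inl i) + y (Inr i)) = R" "(\<lambda>i. d i + y (Inr i) + y (Inl i)) = R"
      "(\<lambda>i. d i + (y (Inl i) + y (Inr i))) = R"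
      "(\<lambda>i. - y (Inl i)) = P" "(\<lambda>i. - y (Inr i)) = Q" "(\<lambda>i. d i + y (Inl i)) = (\<lambda>i. Q i + R i)"
      "(\<lambda>i. d i + y (Inr i)) = (\<lambda>i. P i + R i)"
      "(\<lambda>i. - (y (Inl i) + y (Inr i))) = (\<lambda>i. P i + Q i)" "(\<lambda>i. P i + Q i + y (Inl i)) = Q"
      "(\<lambda>i. P i + R i + y (Inl i)) = R" "(\<lambda>i. Q i + R i + y (Inr i)) = R"
    if "P = (\<lambda>i. - y (Inl i))" "Q = (\<lambda>i. - y (Inr i))" "R = (\<lambda>i. d i + (y (Inl i) + y (Inr i)))"
    for d P Q R and y :: "5 + 5 \<Rightarrow> 'a"
    by (simp_all add: that fun_eq_iff)
  \<comment> \<open>The outer bracket is evaluated first, its momenta being shifted by the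
    substituted variables; the inner one then appears as an argument of \<open>br_vec\<close> and
    \<open>br_form\<close>.\<close>
  have ev:
    "eval_mp (\<lambda>v. vec_at d v t) y (psubst hscale mu2 (\<lambda>x. br_at hscale hbr lam2 a x) (hbr b c)) =
      br_vec P (\<lambda>i. Q i + R i) (vec_at P a) (form_at P a) (br_vec Q R (vec_at Q b) (form_at Q b) (vec_at R c) (form_at R c))
        (br_form Q R (vec_at Q b) (form_at Q b) (vec_at R c) (form_at R c)) t"
    "eval_mp (\<lambda>v. form_at d v i j) y (psubst hscale mu2 (\<lambda>x. br_at hscale hbr lam2 a x) (hbr b c)) =
      br_form P (\<lambda>i. Q i + R i) (vec_at P a) (form_at P a) (br_vec Q R (vec_at Q b) (form_at Q b) (vec_at R c) (form_at R c))
        (br_form Q R (vec_at Q b) (form_at Q b) (vec_at R c) (form_at R c)) i j"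
    "eval_mp (\<lambda>v. vec_at d v t) y (psubst hscale lam2 (\<lambda>x. br_at hscale hbr mu2 b x) (hbr a c)) =
      br_vec Q (\<lambda>i. P i + R i) (vec_at Q b) (form_at Q b) (br_vec P R (vec_at P a) (form_at P a) (vec_at R c) (form_at R c))
        (br_form P R (vec_at P a) (form_at P a) (vec_at R c) (form_at R c)) t"
    "eval_mp (\<lambda>v. form_at d v i j) y (psubst hscale lam2 (\<lambda>x. br_at hscale hbr mu2 b x) (hbr a c)) =
      br_form Q (\<lambda>i. P i + R i) (vec_at Q b) (form_at Q b) (br_vec P R (vec_at P a) (form_at P a) (vec_at R c) (form_at R c))
        (br_form P R (vec_at P a) (form_at P a) (vec_at R c) (form_at R c)) i j"
    "eval_mp (\<lambda>v. vec_at d v t) y (psubst hscale lam2 (\<lambda>x. br_at hscale hbr (\<lambda>i. lam2 i + mu2 i) x c) (hbr a b)) =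
      br_vec (\<lambda>i. P i + Q i) R (br_vec P Q (vec_at P a) (form_at P a) (vec_at Q b) (form_at Q b))
        (br_form P Q (vec_at P a) (form_at P a) (vec_at Q b) (form_at Q b)) (vec_at R c) (form_at R c) t"
    "eval_mp (\<lambda>v. form_at d v i j) y (psubst hscale lam2 (\<lambda>x. br_at hscale hbr (\<lambda>i. lam2 i + mu2 i) x c) (hbr a b)) =
      br_form (\<lambda>i. P i + Q i) R (br_vec P Q (vec_at P a) (form_at P a) (vec_at Q b) (form_at Q b))
        (br_form P Q (vec_at P a) (form_at P a) (vec_at Q b) (form_at Q b)) (vec_at R c) (form_at R c) i j"
    if "P = (\<lambda>i. - y (Inl i))" "Q = (\<lambda>i. - y (Inr i))" "R = (\<lambda>i. d i + (y (Inl i) + y (Inr i)))"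
    for d t i j P Q R and y :: "5 + 5 \<Rightarrow> 'a"
    by (simp_all only: vec_at.ev_psubst form_at.ev_psubst vec_at.ev_br_at form_at.ev_br_at hbr_components eval_mp_br_left eval_mp_br_right
      eval_lam_del_pvar eval_lam_del.add momenta[OF that])
  note RE_components(1)[OF RE(1)] RE_components(1)[OF RE(2)] RE_components(1)[OF c]
    RE_components(2)[OF RE(1)] RE_components(2)[OF RE(2)] RE_components(2)[OF c]
  note facts = this alternating_form_at jacobi_even_even_X jacobi_even_even_W jacobi_even_odd_X jacobi_even_odd_W
    jacobi_odd_even_X jacobi_odd_even_W jacobi_odd_odd_X jacobi_odd_odd_W
  show ?thesis
  proof (rule hpoly_eqI)
    fix d :: "5 \<Rightarrow> 'a" and y :: "5 + 5 \<Rightarrow> 'a" and t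
    define P where "P = (\<lambda>i. - y (Inl i))"
    define Q where "Q = (\<lambda>i. - y (Inr i))"
    define R where "R = (\<lambda>i. d i + (y (Inl i) + y (Inr i)))"
    show "eval_mp (\<lambda>v. vec_at d v t) y (psubst hscale mu2 (\<lambda>x. br_at hscale hbr lam2 a x) (hbr b c)) =
      eval_mp (\<lambda>v. vec_at d v t) y (psubst hscale lam2 (\<lambda>x. br_at hscale hbr (\<lambda>i. lam2 i + mu2 i) x c) (hbr a b) +
      pscale hscale (koszul p q) (psubst hscale lam2 (\<lambda>x. br_at hscale hbr mu2 b x) (hbr a c)))"
      \<comment> \<open>The parities of \<open>a\<close> and \<open>b\<close> make one component of
        each vanish, leaving exactly one of the pointwise Jacobi identities; membership in
        \<open>RE\<close> supplies its divergence and closedness hypotheses.\<close>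
      unfolding vec_eval.add vec_at.ev_pscale k ev[OF P_def Q_def R_def] using a b
      by (cases p; cases q)
        (simp_all add: RE_grade_def hgrade_0_iff hgrade_1_iff koszul_def, (intro facts)+)
  next
    fix d :: "5 \<Rightarrow> 'a" and y :: "5 + 5 \<Rightarrow> 'a" and i j
    define P where "P = (\<lambda>i. - y (Inl i))"
    define Q where "Q = (\<lambda>i. - y (Inr i))"
    define R where "R = (\<lambda>i. d i + (y (Inl i) + y (Inr i)))"
    show "eval_mp (\<lambda>v. form_at d v i j) y (psubst hscale mu2 (\<lambda>x. br_at hscale hbr lam2 a x) (hbr b c)) =
      eval_mp (\<lambda>v. form_at d v i j) y (psubst hscale lam2 (\<lambda>x. br_at hscale hbr (\<lambda>i. lam2 i + mu2 i) x c) (hbr a b) +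
      pscale hscale (koszul p q) (psubst hscale lam2 (\<lambda>x. br_at hscale hbr mu2 b x) (hbr a c)))"
      unfolding form_eval.add form_at.ev_pscale k ev[OF P_def Q_def R_def] using a b
      by (cases p; cases q)
        (simp_all add: RE_grade_def hgrade_0_iff hgrade_1_iff koszul_def, (intro facts)+)
  qed
qed

lemma (in module) subspace_set_sum:
  assumes "subspace S" "subspace T"
  shows "subspace {x + y |x y. x \<in> S \<and> y \<in> T}"
proof (rule subspaceI)
  show "0 \<in> {x + y |x y. x \<in> S \<and> y \<in> T}"
    using subspace_0[OF assms(1)] subspace_0[OF assms(2)] by force
next
  fix u v assume "u \<in> {x + y |x y. x \<in> S \<and> y \<in> T}" "v \<in> {x + y |x y. x \<in> S \<and> y \<in> T}"
  then obtain x y x' y' where "u = x + y" "v = x' + y'" "x \<in> S" "x' \<in> S" "y \<in> T" "y' \<in> T" by blast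
  moreover from this have "u + v = (x + x') + (y + y')" "x + x' \<in> S" "y + y' \<in> T"
    using assms by (simp_all add: subspace_add algebra_simps)
  ultimately show "u + v \<in> {x + y |x y. x \<in> S \<and> y \<in> T}" by blast
next
  fix c u assume "u \<in> {x + y |x y. x \<in> S \<and> y \<in> T}"
  then obtain x y where "u = x + y" "x \<in> S" "y \<in> T" by blast
  moreover from this have "c *s u = c *s x + c *s y" "c *s x \<in> S" "c *s y \<in> T"
    using assms by (simp_all add: subspace_scale scale_right_distrib)
  ultimately show "c *s u \<in> {x + y |x y. x \<in> S \<and> y \<in> T}" by blast
qed

text \<open>The generators are homogeneous, and sums of an even and an odd element of
  \<open>RE\<close> form a submodule, which therefore contains their span.\<close>

lemma RE_grade_sum: "RE = {x + y |x y. x \<in> RE_grade 0 \<and> y \<in> (RE_grade 1 :: 'a::{idom, ring_char_0} hatRE set)}"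
proof
  have sub: "hatRE.subspace (RE_grade p :: 'a hatRE set)" for p
    unfolding RE_grade_def by (intro hatRE.subspace_inter subspace_RE subspace_hgrade)
  show "RE \<subseteq> {x + y |x y. x \<in> RE_grade 0 \<and> y \<in> (RE_grade 1 :: 'a hatRE set)}"
  proof (rule RE_minimal)
    show "a_gen i j \<in> {x + y |x y. x \<in> RE_grade 0 \<and> y \<in> (RE_grade 1 :: 'a hatRE set)}" for i j
      using a_gen_in_RE_grade[of i j] hatRE.subspace_0[OF sub[of 1]] by force
    show "b_gen k \<in> {x + y |x y. x \<in> RE_grade 0 \<and> y \<in> (RE_grade 1 :: 'a hatRE set)}" for k
      using b_gen_in_RE_grade[of k] hatRE.subspace_0[OF sub[of 0]] by force
    show "hatRE.subspace {x + y |x y. x \<in> RE_grade 0 \<and> y \<in> (RE_grade 1 :: 'a hatRE set)}"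
      by (rule module.subspace_set_sum[OF module_hscale sub sub])
  qed
  show "{x + y |x y. x \<in> RE_grade 0 \<and> y \<in> (RE_grade 1 :: 'a hatRE set)} \<subseteq> RE"
    by (auto simp: RE_grade_def intro: hatRE.subspace_add[OF subspace_RE])
qed

lemma lie_conformal_superalgebra_RE:
  "lie_conformal_superalgebra
    (hscale :: (5, 'a::field_char_0) mpoly \<Rightarrow> 'a hatRE \<Rightarrow> 'a hatRE) RE RE_grade hbr"
proof (intro lie_conformal_superalgebra.intro lie_conformal_superalgebra_axioms.intro)
  fix a b :: "'a hatRE" and p q :: bit and n
  show "module (hscale :: (5, 'a) mpoly \<Rightarrow> 'a hatRE \<Rightarrow> 'a hatRE)" by (rule module_hscale)
  show "hatRE.subspace (RE :: 'a hatRE set)" by (rule subspace_RE)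
  show "hatRE.subspace (RE_grade p :: 'a hatRE set)"
    unfolding RE_grade_def by (intro hatRE.subspace_inter subspace_RE subspace_hgrade)
  show "RE = {x + y |x y. x \<in> RE_grade 0 \<and> y \<in> (RE_grade 1 :: 'a hatRE set)}" by (rule RE_grade_sum)
  show "RE_grade 0 \<inter> RE_grade 1 = {0 :: 'a hatRE}"
  proof -
    have "x = 0" if "x \<in> hgrade 0" "x \<in> hgrade 1" for x :: "'a hatRE"
      using that by (intro hatRE_eqI) (simp_all add: hgrade_0_iff hgrade_1_iff)
    then show ?thesis
      using hatRE.subspace_0[OF subspace_RE] hatRE.subspace_0[OF subspace_hgrade] by (auto simp: RE_grade_def)
  qed
  show "Poly_Mapping.lookup (hbr a b) n \<in> RE" if "a \<in> RE" "b \<in> RE"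
    using RE_poly_hbr[OF that] by (simp add: RE_poly_def)
  show "Poly_Mapping.lookup (hbr a b) n \<in> RE_grade (p + q)" if "a \<in> RE_grade p" "b \<in> RE_grade q"
    using that RE_poly_hbr[of a b] hbr_parity[of a p b q] by (simp add: RE_grade_def RE_poly_def)
  show "hbr b a = - pscale hscale (koszul p q) (br_at hscale hbr (\<lambda>i. - lam i - del i) a b)"
    if "a \<in> RE_grade p" "b \<in> RE_grade q"
    using that by (intro hbr_skew_symmetric) (auto simp: RE_grade_def)
\<comment> \<open>The axioms left are additivity, scalars, sesquilinearity and Jacobi. Those on
  scalars and on \<open>\<partial>\<close> are instances of \<open>hbr_hscale_left\<close> and
  \<open>hbr_hscale_right\<close>, whose condition on values is computed.\<close>
qed (rule hbr_add_left hbr_add_right hbr_jacobi; assumption | rule hbr_hscale_left hbr_hscale_right; simp)+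

theorem theorem6p11:
  shows "lie_conformal_superalgebra
      (hscale :: (5, 'a::{alg_closed_field, field_char_0}) mpoly \<Rightarrow> 'a hatRE \<Rightarrow> 'a hatRE)
      RE RE_grade hbr
    \<and> (\<forall>i j r s. hbr (a_gen i j :: 'a hatRE) (a_gen r s) =
        (lam j * lam r) \<cdot> a_gen s i + (lam i * lam r) \<cdot> a_gen j s
        + (lam i * lam s) \<cdot> a_gen r j + (lam j * lam s) \<cdot> a_gen i r
        + (lam i * del j) \<cdot> a_gen r s + (lam j * del i) \<cdot> a_gen s r)
    \<and> (\<forall>i j k. hbr (a_gen i j :: 'a hatRE) (b_gen k) =
        (lam i * del j - lam j * del i) \<cdot> b_gen k
        + pscale hscale ((if i = k then lam j else 0) - (if j = k then lam i else 0))
            (\<Sum>r\<in>UNIV. lam r \<cdot> b_gen r))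
    \<and> (\<forall>i. hbr (b_gen i :: 'a hatRE) (b_gen i) = 0)
    \<and> (\<forall>i j h k l. i \<noteq> j \<and> {i, j, h, k, l} = UNIV \<longrightarrow>
        hbr (b_gen i :: 'a hatRE) (b_gen j) =
        pscale hscale (of_int (sign5 i j h k l))
          (lam h \<cdot> a_gen k l + lam k \<cdot> a_gen l h + lam l \<cdot> a_gen h k))"
  using lie_conformal_superalgebra_RE hbr_a_a hbr_a_b hbr_b_b_same hbr_b_b by blast

end
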